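(* Let $n\ge 4$ be an integer and let $\frac13\leq p\leq\frac12$. Then $M_3(n,p)=\mu_p(\mathrm{BD}_3(n))$. Moreover, $\mathrm{BD}_3(n)$ is the only optimal family up to isomorphism, that is, if $\mathcal F\subset 2^{[n]}$ is a non-trivial $3$-wise intersecting family with $\mu_p(\mathcal F)=M_3(n,p)$, then $\mathcal F\cong\mathrm{BD}_3(n)$.
   Context: Let $[n]=\{1,2,\ldots,n\}$ and let $2^{[n]}$ be its power set. For $0<p<1$, $q=1-p$, the $p$-measure of a family $\mathcal G\subset 2^{[n]}$ is $\mu_p(\mathcal G)=\sum_{G\in\mathcal G}p^{|G|}q^{n-|G|}$. A family $\mathcal G\subset 2^{[n]}$ is $3$-wise intersecting if $G_1\cap G_2\cap G_3\neq\emptyset$ for all $G_1,G_2,G_3\in\mathcal G$ (not necessarily distinct); it is non-trivial if $\bigcap_{G\in\mathcal G}G=\emptyset$. $M_3(n,p)$ denotes the maximum of $\mu_p(\mathcal G)$ over all non-trivial $3$-wise intersecting families $\mathcal G\subset 2^{[n]}$. The family $\mathrm{BD}_3(n)$ is $\{F\in 2^{[n]}:|F\cap[4]|\geq 3\}$; its $p$-measure is $4p^3q+p^4$. Two families $\mathcal F,\mathcal G\subset 2^{[n]}$ are isomorphic, written $\mathcal F\cong\mathcal G$, if there is a permutation $\tau$ of $[n]$ such that $\mathcal F=\{\{\tau(g):g\in G\}:G\in\mathcal G\}$. *)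

theory Defs
  imports Complex_Main "HOL-Combinatorics.Permutations"
begin

definition p_measure :: "nat \<Rightarrow> real \<Rightarrow> nat set set \<Rightarrow> real" where
  "p_measure n p \<G> = (\<Sum>G\<in>\<G>. p ^ card G * (1 - p) ^ (n - card G))"

definition three_wise_intersecting :: "nat set set \<Rightarrow> bool" where
  "three_wise_intersecting \<G> \<longleftrightarrow>
     (\<forall>G1\<in>\<G>. \<forall>G2\<in>\<G>. \<forall>G3\<in>\<G>. G1 \<inter> G2 \<inter> G3 \<noteq> {})"

text \<open>The intersection over the empty family is the whole type, so the empty family is trivial
  (as it is when the empty intersection is read as the nonempty ground set).\<close>

definition non_trivial :: "nat set set \<Rightarrow> bool" where
  "non_trivial \<G> \<longleftrightarrow> \<Inter>\<G> = {}"

definition nontrivial_families :: "nat \<Rightarrow> nat set set set" where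
  "nontrivial_families n =
     {\<G>. \<G> \<subseteq> Pow {1..n} \<and> three_wise_intersecting \<G> \<and> non_trivial \<G>}"

definition M3 :: "nat \<Rightarrow> real \<Rightarrow> real" where
  "M3 n p = Max (p_measure n p ` nontrivial_families n)"

definition BD3 :: "nat \<Rightarrow> nat set set" where
  "BD3 n = {F \<in> Pow {1..n}. card (F \<inter> {1..4}) \<ge> 3}"

definition isomorphic_families :: "nat \<Rightarrow> nat set set \<Rightarrow> nat set set \<Rightarrow> bool" where
  "isomorphic_families n \<F> \<G> \<longleftrightarrow> (\<exists>\<tau>. \<tau> permutes {1..n} \<and> \<F> = {\<tau> ` G | G. G \<in> \<G>})"

text \<open>The maximum defining \<^const>\<open>M3\<close> ranges over a finite set, which is nonempty for
  \<open>n \<ge> 4\<close>.\<close>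

lemma finite_nontrivial_families: "finite (nontrivial_families n)"
  by (rule finite_subset[of _ "Pow (Pow {1..n})"]) (auto simp: nontrivial_families_def)

lemma BD3_in_nontrivial_families:
  assumes "n \<ge> 4"
  shows "BD3 n \<in> nontrivial_families n"
proof -
  have "G1 \<inter> G2 \<inter> G3 \<noteq> {}"
    if "G1 \<in> BD3 n" "G2 \<in> BD3 n" "G3 \<in> BD3 n" for G1 G2 G3
  proof
    assume e: "G1 \<inter> G2 \<inter> G3 = {}"
    have c: "card ({1..4} - G) \<le> 1" if "G \<in> BD3 n" for G
      using that card_Diff_subset_Int[of "{1..4}" G] by (auto simp: BD3_def Int_commute)
    have "{1..4} \<subseteq> ({1..4} - G1) \<union> ({1..4} - G2) \<union> ({1..4::nat} - G3)"
      using e by blast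
    then have "card {1..4::nat} \<le> card (({1..4} - G1) \<union> ({1..4} - G2) \<union> ({1..4} - G3))"
      by (intro card_mono) auto
    also have "\<dots> \<le> card ({1..4} - G1) + card ({1..4} - G2) + card ({1..4} - G3)"
      by (meson add_le_mono1 card_Un_le le_trans)
    also have "\<dots> \<le> 3" using c[OF that(1)] c[OF that(2)] c[OF that(3)] by simp
    finally show False by simp
  qed
  moreover have "\<Inter>(BD3 n) = {}"
  proof -
    have "{1..n} - {i} \<in> BD3 n" for i
    proof -
      have "({1..n} - {i}) \<inter> {1..4} = {1..4} - {i}" using assms by auto
      then show ?thesis by (auto simp: BD3_def card_Diff_singleton_if)
    qed
    then show ?thesis by blast
  qed
  ultimately show ?thesis
    unfolding nontrivial_families_def three_wise_intersecting_def non_trivial_def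
    by (auto simp: BD3_def)
qed

end

theory Submission
  imports Defs
begin

text \<open>
  If two members of a 3-wise intersecting family meet in a single point, that point lies in every
  member; hence a non-trivial family is also 2-intersecting, meaning that any two members share at
  least two points. The measure is maximised over all 2-intersecting families, which are moreover
  required to be 3-wise intersecting when \<open>p \<ge> 2/5\<close>. This class, unlike the class of non-trivial
  families, is closed under shifting, and the optimal shifted members are \<open>BD\<^sub>3\<close> and, at
  \<open>p = 1/3\<close>, also the family of all sets containing \<open>{1, 2}\<close>.

  For \<open>p < 2/5\<close> this is the generating set argument of Ahlswede and Khachatrian. For
  \<open>p \<ge> 2/5\<close>, split a shifted family that is not contained in \<open>BD\<^sub>3\<close> according to the traces
  on \<open>{1, 2, 3, 4}\<close>. The sixteen links are bounded in three ways: cross-intersecting pairs have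
  total measure at most 1, the sets containing 1 have an intersecting link, of measure at most
  \<open>p\<close>, and by shiftedness the walks associated with the members of a link reach a certain
  height \<open>u\<close>, which has probability at most \<open>\<alpha> ^ u\<close> where \<open>\<alpha> = p + (1 - p) \<alpha>\<^sup>3\<close>.

  Both optimal shifted families can be traced back through a shift up to isomorphism, and
  non-triviality excludes the second one.
\<close>

definition pm :: "real \<Rightarrow> nat set \<Rightarrow> (nat set \<Rightarrow> bool) \<Rightarrow> real" where
  "pm p V P = (\<Sum>B\<in>{B \<in> Pow V. P B}. p ^ card B * (1 - p) ^ (card V - card B))"

lemma pm_cong:
  assumes "\<And>B. B \<subseteq> V \<Longrightarrow> P B = Q B"
  shows "pm p V P = pm p V Q"
  unfolding pm_def using assms by (intro sum.cong) auto

lemma p_measure_eq_pm: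
  assumes "\<F> \<subseteq> Pow {1..n}"
  shows "p_measure n p \<F> = pm p {1..n} (\<lambda>A. A \<in> \<F>)"
proof -
  have "{B \<in> Pow {1..n}. B \<in> \<F>} = \<F>" using assms by auto
  then show ?thesis by (simp add: pm_def p_measure_def)
qed

lemma pm_empty [simp]: "pm p {} P = (if P {} then 1 else 0)"
proof -
  have "{B \<in> Pow {}. P B} = (if P {} then {{}} else {})" by auto
  then show ?thesis by (simp add: pm_def)
qed

text \<open>Conditioning on whether v is chosen. Predicates are used in place of families so that
  both links at v are again predicates, on the smaller ground set, without any new family being
  built; inductions over V and expansions by traces all rest on this recursion.\<close>

lemma pm_insert:
  assumes "finite V" "v \<notin> V"
  shows "pm p (insert v V) P = p * pm p V (\<lambda>B. P (insert v B)) + (1 - p) * pm p V P"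
proof -
  let ?w = "\<lambda>B. p ^ card B * (1 - p) ^ (card (insert v V) - card B)"
  have split: "{B \<in> Pow (insert v V). P B}
      = insert v ` {B \<in> Pow V. P (insert v B)} \<union> {B \<in> Pow V. P B}"
  proof -
    have "B \<in> insert v ` {B \<in> Pow V. P (insert v B)}"
      if "B \<subseteq> insert v V" "P B" "\<not> B \<subseteq> V" for B
    proof (rule image_eqI[of _ _ "B - {v}"])
      show "B = insert v (B - {v})" using that by auto
      then show "B - {v} \<in> {B \<in> Pow V. P (insert v B)}" using that by auto
    qed
    then show ?thesis by auto
  qed
  have inj: "inj_on (insert v) {B \<in> Pow V. P (insert v B)}"
    using assms(2) by (auto simp: inj_on_def insert_ident)
  have "pm p (insert v V) P
      = sum ?w (insert v ` {B \<in> Pow V. P (insert v B)}) + sum ?w {B \<in> Pow V. P B}"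
    unfolding pm_def split using assms by (intro sum.union_disjoint) auto
  also have "sum ?w (insert v ` {B \<in> Pow V. P (insert v B)})
      = (\<Sum>B\<in>{B \<in> Pow V. P (insert v B)}. p * (p ^ card B * (1 - p) ^ (card V - card B)))"
    unfolding sum.reindex[OF inj] o_def
  proof (rule sum.cong)
    fix B assume "B \<in> {B \<in> Pow V. P (insert v B)}"
    then have "B \<subseteq> V" by simp
    then have "finite B" "v \<notin> B" using assms finite_subset by auto
    then show "?w (insert v B) = p * (p ^ card B * (1 - p) ^ (card V - card B))"
      using assms by simp
  qed simp
  also have "sum ?w {B \<in> Pow V. P B}
      = (\<Sum>B\<in>{B \<in> Pow V. P B}. (1 - p) * (p ^ card B * (1 - p) ^ (card V - card B)))"
  proof (rule sum.cong)
    fix B assume "B \<in> {B \<in> Pow V. P B}"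
    then have "card B \<le> card V" using assms by (simp add: card_mono)
    then show "?w B = (1 - p) * (p ^ card B * (1 - p) ^ (card V - card B))"
      using assms by (simp add: Suc_diff_le)
  qed simp
  finally show ?thesis by (simp add: pm_def sum_distrib_left)
qed

lemma pm_True: "finite V \<Longrightarrow> pm p V (\<lambda>_. True) = 1"
  by (induction V rule: finite_induct) (simp_all add: pm_insert)

lemma pm_nonneg: "0 \<le> p \<Longrightarrow> p \<le> 1 \<Longrightarrow> 0 \<le> pm p V P"
  unfolding pm_def by (intro sum_nonneg) auto

lemma pm_mono:
  assumes "0 \<le> p" "p \<le> 1" "finite V" "\<And>B. B \<subseteq> V \<Longrightarrow> P B \<Longrightarrow> Q B"
  shows "pm p V P \<le> pm p V Q"
  unfolding pm_def using assms by (intro sum_mono2) auto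

lemma pm_le_1: "0 \<le> p \<Longrightarrow> p \<le> 1 \<Longrightarrow> finite V \<Longrightarrow> pm p V P \<le> 1"
  using pm_mono[of p V P "\<lambda>_. True"] pm_True by simp

lemma pm_eq_0: "(\<And>B. B \<subseteq> V \<Longrightarrow> \<not> P B) \<Longrightarrow> pm p V P = 0"
  unfolding pm_def by (intro sum.neutral) auto

lemma pm_or_and:
  assumes "finite V"
  shows "pm p V (\<lambda>B. P B \<or> Q B) + pm p V (\<lambda>B. P B \<and> Q B) = pm p V P + pm p V Q"
proof -
  have "{B \<in> Pow V. P B \<or> Q B} = {B \<in> Pow V. P B} \<union> {B \<in> Pow V. Q B}"
    "{B \<in> Pow V. P B \<and> Q B} = {B \<in> Pow V. P B} \<inter> {B \<in> Pow V. Q B}" by auto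
  then show ?thesis unfolding pm_def using assms by (simp add: sum.union_inter)
qed

lemma pm_restrict:
  assumes "finite W" "finite V" "W \<inter> V = {}"
  shows "pm p (W \<union> V) (\<lambda>A. P (A \<inter> V)) = pm p V P"
  using assms
proof (induction W rule: finite_induct)
  case empty
  then show ?case by (auto intro: pm_cong simp: Int_absorb2)
next
  case (insert w W)
  then have "w \<notin> W \<union> V" "finite (W \<union> V)" "\<And>B. insert w B \<inter> V = B \<inter> V" by auto
  then show ?case using insert by (simp add: pm_insert algebra_simps)
qed

lemma p_measure_psubset:
  assumes "0 < p" "p < 1" "\<G> \<subseteq> Pow {1..n}" "\<F> \<subset> \<G>"
  shows "p_measure n p \<F> < p_measure n p \<G>"
proof -
  have fin: "finite \<G>" using assms(3) finite_subset by auto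
  obtain A where A: "A \<in> \<G>" "A \<notin> \<F>" using assms(4) by blast
  have "p_measure n p \<F> < p_measure n p (insert A \<F>)"
    unfolding p_measure_def using A assms fin finite_subset[of \<F> \<G>] by auto
  also have "\<dots> \<le> p_measure n p \<G>"
    unfolding p_measure_def using A assms fin by (intro sum_mono2) auto
  finally show ?thesis .
qed

text \<open>After splitting at v, the two links containing v need not be cross-intersecting, since v
  itself may be the common point. The total is therefore regrouped into the other three pairs of
  links, with weights p, p and 1 - 2p; the last is nonnegative because p \<le> 1/2.\<close>

lemma pm_cross_intersecting:
  assumes "0 \<le> p" "p \<le> 1/2" "finite V"
    and "\<And>A B. A \<subseteq> V \<Longrightarrow> B \<subseteq> V \<Longrightarrow> P A \<Longrightarrow> Q B \<Longrightarrow> A \<inter> B \<noteq> {}"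
  shows "pm p V P + pm p V Q \<le> 1"
  using assms(3,4)
proof (induction V arbitrary: P Q rule: finite_induct)
  case empty
  then show ?case by auto
next
  case (insert v V)
  have cross: "A \<inter> B \<noteq> {}" if "A \<subseteq> insert v V" "B \<subseteq> insert v V" "P A" "Q B" for A B
    using insert.prems that by blast
  let ?P1 = "\<lambda>A. P (insert v A)" and ?Q1 = "\<lambda>A. Q (insert v A)"
  have 1: "pm p V ?P1 + pm p V Q \<le> 1"
  proof (rule insert.IH)
    fix A B assume "A \<subseteq> V" "B \<subseteq> V" "P (insert v A)" "Q B"
    then show "A \<inter> B \<noteq> {}" using cross[of "insert v A" B] insert.hyps by auto
  qed
  have 2: "pm p V P + pm p V ?Q1 \<le> 1"
  proof (rule insert.IH)
    fix A B assume "A \<subseteq> V" "B \<subseteq> V" "P A" "Q (insert v B)"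
    then show "A \<inter> B \<noteq> {}" using cross[of A "insert v B"] insert.hyps by auto
  qed
  have 3: "pm p V P + pm p V Q \<le> 1"
  proof (rule insert.IH)
    fix A B assume "A \<subseteq> V" "B \<subseteq> V" "P A" "Q B"
    then show "A \<inter> B \<noteq> {}" using cross[of A B] by auto
  qed
  have "pm p (insert v V) P + pm p (insert v V) Q
      = p * (pm p V ?P1 + pm p V Q) + p * (pm p V P + pm p V ?Q1)
        + (1 - 2 * p) * (pm p V P + pm p V Q)"
    using insert.hyps by (simp add: pm_insert algebra_simps)
  also have "\<dots> \<le> p * 1 + p * 1 + (1 - 2 * p) * 1"
    using 1 2 3 assms(1,2) by (intro add_mono mult_left_mono) auto
  finally show ?case by simp
qed

section \<open>Shifting\<close>

definition swap :: "nat \<Rightarrow> nat \<Rightarrow> nat set \<Rightarrow> nat set" where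
  "swap i j A = transpose i j ` A"

text \<open>Written as a membership test: of the two sets A and \<open>swap i j A\<close> that
  contain exactly one of i and j, the one with i survives if either was present, the one with j only
  if both were.\<close>

definition shift :: "nat \<Rightarrow> nat \<Rightarrow> nat set set \<Rightarrow> nat set set" where
  "shift i j \<F> = {A. if i \<in> A \<and> j \<notin> A then A \<in> \<F> \<or> swap i j A \<in> \<F>
                     else if j \<in> A \<and> i \<notin> A then A \<in> \<F> \<and> swap i j A \<in> \<F>
                     else A \<in> \<F>}"

definition shifted :: "nat set set \<Rightarrow> bool" where
  "shifted \<F> \<longleftrightarrow>
     (\<forall>A\<in>\<F>. \<forall>i j. 1 \<le> i \<and> i < j \<and> j \<in> A \<and> i \<notin> A \<longrightarrow> insert i (A - {j}) \<in> \<F>)"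

definition up_closed :: "nat \<Rightarrow> nat set set \<Rightarrow> bool" where
  "up_closed n \<F> \<longleftrightarrow> (\<forall>A\<in>\<F>. \<forall>B. A \<subseteq> B \<and> B \<subseteq> {1..n} \<longrightarrow> B \<in> \<F>)"

lemma swap_swap [simp]: "swap i j (swap i j A) = A"
  by (simp add: swap_def image_image)

lemma mem_swap_iff: "x \<in> swap i j A \<longleftrightarrow> transpose i j x \<in> A"
  unfolding swap_def by (metis (no_types) image_iff transpose_involutory)

lemma swap_same: "(i \<in> A \<longleftrightarrow> j \<in> A) \<Longrightarrow> swap i j A = A"
  by (auto simp: mem_swap_iff transpose_def split: if_splits)

lemma swap_right: "j \<in> A \<Longrightarrow> i \<notin> A \<Longrightarrow> swap i j A = insert i (A - {j})"
  by (auto simp: mem_swap_iff transpose_def split: if_splits)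

lemma swap_left: "i \<in> A \<Longrightarrow> j \<notin> A \<Longrightarrow> swap i j A = insert j (A - {i})"
  by (auto simp: mem_swap_iff transpose_def split: if_splits)

lemma card_swap [simp]: "card (swap i j A) = card A"
  unfolding swap_def by (intro card_image) (auto simp: inj_on_def transpose_eq_iff)

lemma swap_subset: "i \<in> V \<Longrightarrow> j \<in> V \<Longrightarrow> A \<subseteq> V \<Longrightarrow> swap i j A \<subseteq> V"
  by (force simp: mem_swap_iff transpose_def split: if_splits)

lemma shift_subset:
  assumes "\<F> \<subseteq> Pow {1..n}" "i \<in> {1..n}" "j \<in> {1..n}"
  shows "shift i j \<F> \<subseteq> Pow {1..n}"
proof
  fix A assume "A \<in> shift i j \<F>"
  then have "A \<in> \<F> \<or> swap i j A \<in> \<F>" by (auto simp: shift_def split: if_splits)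
  then show "A \<in> Pow {1..n}" using assms swap_subset[of i "{1..n}" j "swap i j A"] by auto
qed

text \<open>Splitting by the trace on {i, j}, only the links of {i} and {j} change. They have the
  same weight p (1 - p), and the shift replaces them by their union and their intersection, which
  preserves the total.\<close>

lemma p_measure_shift:
  assumes "\<F> \<subseteq> Pow {1..n}" "i \<in> {1..n}" "j \<in> {1..n}" "i \<noteq> j"
  shows "p_measure n p (shift i j \<F>) = p_measure n p \<F>"
proof -
  define W where "W = {1..n} - {i, j}"
  have V: "{1..n} = insert i (insert j W)" "finite W" "i \<notin> insert j W" "j \<notin> W"
    using assms by (auto simp: W_def)
  define x where "x = (\<lambda>I. pm p W (\<lambda>B. I \<union> B \<in> \<F>))"
  have exp: "pm p {1..n} Q = p * p * pm p W (\<lambda>B. Q (insert i (insert j B)))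
      + p * (1 - p) * (pm p W (\<lambda>B. Q (insert i B)) + pm p W (\<lambda>B. Q (insert j B)))
      + (1 - p) * (1 - p) * pm p W Q" for Q
    unfolding V(1) using V(2-4) by (simp add: pm_insert algebra_simps)
  have nW: "i \<notin> B" "j \<notin> B" if "B \<subseteq> W" for B using that by (auto simp: W_def)
  have sw: "swap i j (insert i B) = insert j B" "swap i j (insert j B) = insert i B" if "B \<subseteq> W" for B
    using nW[OF that] assms(4) by (auto simp: swap_left swap_right)
  have "pm p W (\<lambda>B. insert i (insert j B) \<in> shift i j \<F>)
      = pm p W (\<lambda>B. insert i (insert j B) \<in> \<F>)"
    by (rule pm_cong) (simp add: shift_def)
  moreover have "pm p W (\<lambda>B. B \<in> shift i j \<F>) = pm p W (\<lambda>B. B \<in> \<F>)"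
    by (rule pm_cong) (simp add: shift_def nW)
  moreover have "pm p W (\<lambda>B. insert i B \<in> shift i j \<F>)
      = pm p W (\<lambda>B. insert i B \<in> \<F> \<or> insert j B \<in> \<F>)"
    by (rule pm_cong) (use assms(4) in \<open>auto simp: shift_def nW sw\<close>)
  moreover have "pm p W (\<lambda>B. insert j B \<in> shift i j \<F>)
      = pm p W (\<lambda>B. insert i B \<in> \<F> \<and> insert j B \<in> \<F>)"
    by (rule pm_cong) (use assms(4) in \<open>auto simp: shift_def nW sw\<close>)
  ultimately have "pm p {1..n} (\<lambda>A. A \<in> shift i j \<F>) = pm p {1..n} (\<lambda>A. A \<in> \<F>)"
    unfolding exp using pm_or_and[OF V(2), of p "\<lambda>B. insert i B \<in> \<F>" "\<lambda>B. insert j B \<in> \<F>"]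
    by simp
  then show ?thesis
    unfolding p_measure_eq_pm[OF assms(1)] p_measure_eq_pm[OF shift_subset[OF assms(1-3)]] .
qed

text \<open>If some member of \<open>\<X>\<close> is a newly created set, undo the shift on all members of \<open>\<X>\<close>
  for which this is possible. Either this applies the transposition to all of \<open>\<X>\<close>, or the
  new intersection contains neither \<open>i\<close> nor \<open>j\<close>.\<close>

lemma shift_intersection:
  assumes "\<X> \<subseteq> shift i j \<F>" "\<X> \<noteq> {}" "finite (\<Inter>\<X>)"
  obtains g where "g ` \<X> \<subseteq> \<F>" "card (\<Inter>(g ` \<X>)) \<le> card (\<Inter>\<X>)"
proof (cases "\<X> \<subseteq> \<F>")
  case True
  then show ?thesis using that[of "\<lambda>A. A"] by simp
next
  case False
  then obtain A where A: "A \<in> \<X>" "A \<notin> \<F>" by blast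
  then have "A \<in> shift i j \<F>" using assms by blast
  with A have A': "i \<in> A" "j \<notin> A" "swap i j A \<in> \<F>"
    by (auto simp: shift_def split: if_splits)
  define kept where "kept X \<longleftrightarrow> i \<in> X \<and> j \<notin> X \<and> X \<in> \<F>" for X
  define g where "g X = (if kept X then X else swap i j X)" for X
  have "g X \<in> \<F>" if "X \<in> \<X>" for X
  proof -
    have "X \<in> shift i j \<F>" using that assms by blast
    then show ?thesis
      by (cases "i \<in> X"; cases "j \<in> X") (auto simp: g_def kept_def shift_def swap_same)
  qed
  moreover have "card (\<Inter>(g ` \<X>)) \<le> card (\<Inter>\<X>)"
  proof (cases "\<exists>X\<in>\<X>. kept X")
    case True
    then obtain X where X: "X \<in> \<X>" "kept X" by blast
    have gX: "g X = X" and gA: "g A = swap i j A" using X A by (auto simp: g_def kept_def)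
    have "i \<notin> \<Inter>(g ` \<X>)" using A A' gA by (force simp: mem_swap_iff)
    moreover have "j \<notin> \<Inter>(g ` \<X>)" using X gX by (force simp: kept_def)
    moreover have "x \<in> Y" if "x \<in> g Y" "x \<noteq> i" "x \<noteq> j" for x Y
      using that by (auto simp: g_def mem_swap_iff transpose_def split: if_splits)
    ultimately have "\<Inter>(g ` \<X>) \<subseteq> \<Inter>\<X>" by blast
    then show ?thesis using assms(3) card_mono by blast
  next
    case False
    then have "g ` \<X> = swap i j ` \<X>" by (auto simp: g_def)
    moreover have "\<Inter>(swap i j ` \<X>) = swap i j (\<Inter>\<X>)" by (auto simp: mem_swap_iff)
    ultimately show ?thesis by simp
  qed
  ultimately show ?thesis using that[of g] by blast
qed

text \<open>Every set that moves trades j for the smaller i. The total of all elements of all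
  members thus drops, which makes repeated shifting terminate.\<close>

lemma shift_potential:
  assumes "finite \<F>" "\<And>A. A \<in> \<F> \<Longrightarrow> finite A" "i < j" "shift i j \<F> \<noteq> \<F>"
  shows "(\<Sum>A\<in>shift i j \<F>. \<Sum>A) < (\<Sum>A\<in>\<F>. \<Sum>A)"
proof -
  define \<M> where "\<M> = {A \<in> \<F>. j \<in> A \<and> i \<notin> A \<and> swap i j A \<notin> \<F>}"
  have eq: "shift i j \<F> = (\<F> - \<M>) \<union> swap i j ` \<M>"
  proof (rule set_eqI)
    fix A
    have im: "A \<in> swap i j ` \<M> \<longleftrightarrow> swap i j A \<in> \<M>" by (metis image_iff swap_swap)
    show "A \<in> shift i j \<F> \<longleftrightarrow> A \<in> (\<F> - \<M>) \<union> swap i j ` \<M>"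
      unfolding Un_iff Diff_iff im unfolding \<M>_def shift_def using assms(3)
      by (cases "i \<in> A"; cases "j \<in> A") (auto simp: mem_swap_iff swap_same)
  qed
  have fin: "finite \<M>" using assms(1) by (simp add: \<M>_def)
  have inj: "inj_on (swap i j) \<M>" by (metis inj_onI swap_swap)
  have ne: "\<M> \<noteq> {}" using assms(4) eq by auto
  have "(\<Sum>A\<in>shift i j \<F>. \<Sum>A) = (\<Sum>A\<in>\<F> - \<M>. \<Sum>A) + (\<Sum>A\<in>swap i j ` \<M>. \<Sum>A)"
    unfolding eq using assms(1) fin by (intro sum.union_disjoint) (auto simp: \<M>_def)
  also have "(\<Sum>A\<in>swap i j ` \<M>. \<Sum>A) = (\<Sum>A\<in>\<M>. \<Sum>(swap i j A))"
    using sum.reindex[OF inj] by simp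
  also have "\<dots> < (\<Sum>A\<in>\<M>. \<Sum>A)"
  proof (rule sum_strict_mono[OF fin ne])
    fix A assume "A \<in> \<M>"
    then have A: "finite A" "j \<in> A" "i \<notin> A" using assms(2) by (auto simp: \<M>_def)
    then have "\<Sum>(swap i j A) = i + \<Sum>(A - {j})" by (simp add: swap_right)
    also have "\<dots> < j + \<Sum>(A - {j})" using assms(3) by simp
    also have "\<dots> = \<Sum>A" using A by (simp add: sum.remove)
    finally show "\<Sum>(swap i j A) < \<Sum>A" .
  qed
  also have "(\<Sum>A\<in>\<F> - \<M>. \<Sum>A) + (\<Sum>A\<in>\<M>. \<Sum>A) = (\<Sum>A\<in>\<F>. \<Sum>A)"
    using assms(1) by (intro sum.subset_diff[symmetric]) (auto simp: \<M>_def)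
  finally show ?thesis by simp
qed

lemma shifted_if_fixed:
  assumes "\<F> \<subseteq> Pow {1..n}"
    and "\<And>i j. 1 \<le> i \<Longrightarrow> i < j \<Longrightarrow> j \<le> n \<Longrightarrow> shift i j \<F> = \<F>"
  shows "shifted \<F>"
  unfolding shifted_def
proof (intro ballI allI impI)
  fix A i j assume A: "A \<in> \<F>" and *: "1 \<le> i \<and> i < j \<and> j \<in> A \<and> i \<notin> A"
  have "A \<subseteq> {1..n}" using A assms(1) by blast
  then have "j \<le> n" using * by auto
  then have "A \<in> shift i j \<F>" using assms(2) A * by simp
  then show "insert i (A - {j}) \<in> \<F>" using * by (auto simp: shift_def swap_right)
qed

section \<open>Optimal families\<close>

definition optimal :: "nat \<Rightarrow> real \<Rightarrow> nat set set set \<Rightarrow> nat set set \<Rightarrow> bool" where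
  "optimal n p \<C> \<F> \<longleftrightarrow> \<F> \<in> \<C> \<and> (\<forall>\<G>\<in>\<C>. p_measure n p \<G> \<le> p_measure n p \<F>)"

text \<open>Exactly the closure properties that the reduction to shifted families needs, isolated
  because they are used both for \<open>t_families\<close> and for \<open>families\<close>. Closure
  under adding one superset suffices to make optimal members up-closed, since an added set raises
  the measure.\<close>

definition shift_class :: "nat \<Rightarrow> nat set set set \<Rightarrow> bool" where
  "shift_class n \<C> \<longleftrightarrow> \<C> \<subseteq> Pow (Pow {1..n}) \<and>
     (\<forall>\<F>\<in>\<C>. (\<forall>A\<in>\<F>. \<forall>B. A \<subseteq> B \<and> B \<subseteq> {1..n} \<longrightarrow> insert B \<F> \<in> \<C>) \<and>
              (\<forall>i j. 1 \<le> i \<and> i < j \<and> j \<le> n \<longrightarrow> shift i j \<F> \<in> \<C>))"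

lemma optimal_exists:
  assumes "shift_class n \<C>" "\<C> \<noteq> {}"
  obtains \<F> where "optimal n p \<C> \<F>"
proof -
  have "finite \<C>" using assms finite_subset[of \<C> "Pow (Pow {1..n})"] by (simp add: shift_class_def)
  then have "Max (p_measure n p ` \<C>) \<in> p_measure n p ` \<C>" using assms(2) by (intro Max_in) auto
  then obtain \<F> where "\<F> \<in> \<C>" "p_measure n p \<F> = Max (p_measure n p ` \<C>)" by auto
  then show ?thesis using that[of \<F>] \<open>finite \<C>\<close> by (simp add: optimal_def)
qed

lemma optimal_up_closed:
  assumes "shift_class n \<C>" "optimal n p \<C> \<F>" "0 < p" "p < 1"
  shows "up_closed n \<F>"
  unfolding up_closed_def
proof (intro ballI allI impI, rule ccontr)
  fix A B assume A: "A \<in> \<F>" "A \<subseteq> B \<and> B \<subseteq> {1..n}" "B \<notin> \<F>"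
  have "insert B \<F> \<in> \<C>" "\<F> \<in> \<C>" using A assms(1,2) by (auto simp: shift_class_def optimal_def)
  then have "p_measure n p \<F> < p_measure n p (insert B \<F>)"
    using assms A by (intro p_measure_psubset) (auto simp: shift_class_def)
  then show False using assms(2) \<open>insert B \<F> \<in> \<C>\<close> by (force simp: optimal_def)
qed

text \<open>A shift keeps the measure, hence optimality, and lowers the potential, so the induction
  ends at shifted families. The step runs backwards, from \<open>shift i j \<F>\<close> to
  \<open>\<F>\<close>, because structural information has to be carried back to the original
  family.\<close>

lemma optimal_shift_induct:
  assumes \<C>: "shift_class n \<C>" and p: "0 < p" "p < 1" and "optimal n p \<C> \<F>"
    and base: "\<And>\<F>. optimal n p \<C> \<F> \<Longrightarrow> up_closed n \<F> \<Longrightarrow> shifted \<F> \<Longrightarrow> P \<F>"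
    and step: "\<And>\<F> i j. optimal n p \<C> \<F> \<Longrightarrow> 1 \<le> i \<Longrightarrow> i < j \<Longrightarrow> j \<le> n \<Longrightarrow>
      P (shift i j \<F>) \<Longrightarrow> P \<F>"
  shows "P \<F>"
  using assms(4)
proof (induction "\<Sum>A\<in>\<F>. \<Sum>A" arbitrary: \<F> rule: less_induct)
  case less
  then have F: "\<F> \<in> \<C>" "\<F> \<subseteq> Pow {1..n}" using \<C> unfolding optimal_def shift_class_def by blast+
  show ?case
  proof (cases "\<exists>i j. 1 \<le> i \<and> i < j \<and> j \<le> n \<and> shift i j \<F> \<noteq> \<F>")
    case True
    then obtain i j where ij: "1 \<le> i" "i < j" "j \<le> n" "shift i j \<F> \<noteq> \<F>" by blast
    have "shift i j \<F> \<in> \<C>" using \<C> F ij by (auto simp: shift_class_def)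
    then have "optimal n p \<C> (shift i j \<F>)"
      using less.prems F ij by (simp add: optimal_def p_measure_shift)
    moreover have "(\<Sum>A\<in>shift i j \<F>. \<Sum>A) < (\<Sum>A\<in>\<F>. \<Sum>A)"
      using F ij finite_subset by (intro shift_potential) (auto dest: finite_subset)
    ultimately show ?thesis using step less ij by blast
  next
    case False
    then have "shifted \<F>" using F by (intro shifted_if_fixed[of \<F> n]) auto
    then show ?thesis using base less.prems optimal_up_closed \<C> p by blast
  qed
qed

section \<open>Intersection conditions preserved by shifting\<close>

definition t_intersecting :: "nat \<Rightarrow> nat set set \<Rightarrow> bool" where
  "t_intersecting t \<F> \<longleftrightarrow> (\<forall>A\<in>\<F>. \<forall>B\<in>\<F>. t \<le> card (A \<inter> B))"

definition t_families :: "nat \<Rightarrow> nat \<Rightarrow> nat set set set" where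
  "t_families n t = {\<F>. \<F> \<subseteq> Pow {1..n} \<and> t_intersecting t \<F>}"

lemma t_intersecting_insert:
  assumes "t_intersecting t \<F>" "\<F> \<subseteq> Pow {1..n}" "A \<in> \<F>" "A \<subseteq> B" "B \<subseteq> {1..n}"
  shows "t_intersecting t (insert B \<F>)"
proof -
  have fin: "finite B" using assms(5) finite_subset by blast
  have B: "t \<le> card (B \<inter> C)" if "C \<in> \<F>" for C
  proof -
    have "t \<le> card (A \<inter> C)" using assms(1,3) that by (auto simp: t_intersecting_def)
    also have "\<dots> \<le> card (B \<inter> C)" using assms fin by (intro card_mono) auto
    finally show ?thesis .
  qed
  have "t \<le> card (B \<inter> A)" by (rule B[OF assms(3)])
  also have "\<dots> \<le> card (B \<inter> B)" using fin by (intro card_mono) auto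
  finally show ?thesis using B assms(1) by (auto simp: t_intersecting_def Int_commute)
qed

lemma t_intersecting_shift:
  assumes "t_intersecting t \<F>" "\<F> \<subseteq> Pow {1..n}" "i \<in> {1..n}" "j \<in> {1..n}"
  shows "t_intersecting t (shift i j \<F>)"
  unfolding t_intersecting_def
proof (intro ballI)
  fix A B assume AB: "A \<in> shift i j \<F>" "B \<in> shift i j \<F>"
  have "A \<subseteq> {1..n}" using shift_subset[OF assms(2-4)] AB by auto
  then have "finite (\<Inter>{A, B})" using finite_subset by auto
  then obtain g where g: "g ` {A, B} \<subseteq> \<F>" "card (\<Inter>(g ` {A, B})) \<le> card (\<Inter>{A, B})"
    using AB shift_intersection[of "{A, B}" i j \<F>] by (metis empty_subsetI insert_not_empty insert_subset)
  then show "t \<le> card (A \<inter> B)" using assms(1) by (force simp: t_intersecting_def)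
qed

lemma three_wise_intersecting_shift:
  assumes "three_wise_intersecting \<F>" "\<F> \<subseteq> Pow {1..n}" "i \<in> {1..n}" "j \<in> {1..n}"
  shows "three_wise_intersecting (shift i j \<F>)"
  unfolding three_wise_intersecting_def
proof (intro ballI)
  fix A B C assume ABC: "A \<in> shift i j \<F>" "B \<in> shift i j \<F>" "C \<in> shift i j \<F>"
  have "A \<subseteq> {1..n}" using shift_subset[OF assms(2-4)] ABC by auto
  then have fA: "finite A" using finite_subset by auto
  then have "finite (\<Inter>{A, B, C})" by auto
  then obtain g where g: "g ` {A, B, C} \<subseteq> \<F>"
      "card (\<Inter>(g ` {A, B, C})) \<le> card (\<Inter>{A, B, C})"
    using ABC shift_intersection[of "{A, B, C}" i j \<F>]
    by (metis empty_subsetI insert_not_empty insert_subset)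
  then have "g A \<inter> g B \<inter> g C \<noteq> {}" "g A \<subseteq> {1..n}"
    using assms(1,2) by (auto simp: three_wise_intersecting_def)
  moreover have "finite (g A)" using calculation finite_subset by auto
  ultimately have "0 < card (\<Inter>(g ` {A, B, C}))" by (auto simp: card_gt_0_iff Int_assoc)
  then have "0 < card (\<Inter>{A, B, C})" using g(2) by simp
  then show "A \<inter> B \<inter> C \<noteq> {}" by (auto simp: Int_assoc)
qed

lemma shift_class_t_families: "shift_class n (t_families n t)"
  unfolding shift_class_def t_families_def
  using t_intersecting_insert t_intersecting_shift shift_subset by auto

section \<open>Generating sets\<close>

lemma p_measure_cylinder:
  assumes "\<K> \<subseteq> Pow {1..m}" "m \<le> n"
  shows "p_measure n p {A \<in> Pow {1..n}. A \<inter> {1..m} \<in> \<K>} = p_measure m p \<K>"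
proof -
  have V: "{1..n} = {m+1..n} \<union> {1..m}" using assms(2) by auto
  have "p_measure n p {A \<in> Pow {1..n}. A \<inter> {1..m} \<in> \<K>}
      = pm p {1..n} (\<lambda>A. A \<in> {A \<in> Pow {1..n}. A \<inter> {1..m} \<in> \<K>})"
    by (rule p_measure_eq_pm) auto
  also have "\<dots> = pm p {1..n} (\<lambda>A. A \<inter> {1..m} \<in> \<K>)" by (rule pm_cong) simp
  also have "\<dots> = pm p {1..m} (\<lambda>A. A \<in> \<K>)"
    unfolding V by (rule pm_restrict) auto
  also have "\<dots> = p_measure m p \<K>" by (rule p_measure_eq_pm[OF assms(1), symmetric])
  finally show ?thesis .
qed

text \<open>Dropping \<open>n\<close> from the members of \<open>\<S>\<close> and discarding \<open>\<D>\<close> keeps the family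
  \<open>t\<close>-intersecting.\<close>

lemma optimal_exchange:
  assumes p: "0 < p" "p < 1" and opt: "optimal n p (t_families n t) \<F>"
    and \<A>: "\<A> = {E \<in> \<F>. E - {n} \<notin> \<F>}"
    and sub: "\<S> \<subseteq> \<A>" "\<D> \<subseteq> \<A>" "\<S> \<inter> \<D> = {}"
    and ncrit: "\<And>E E'. E \<in> \<S> \<Longrightarrow> E' \<in> \<A> - \<D> \<Longrightarrow> t < card (E \<inter> E')"
  shows "(1 - p) * (\<Sum>E\<in>\<S>. p ^ card E * (1 - p) ^ (n - card E))
      \<le> p * (\<Sum>E\<in>\<D>. p ^ card E * (1 - p) ^ (n - card E))"
proof -
  let ?w = "\<lambda>E::nat set. p ^ card E * (1 - p) ^ (n - card E)"
  have F: "\<F> \<subseteq> Pow {1..n}" "t_intersecting t \<F>"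
    using opt by (auto simp: optimal_def t_families_def)
  have finF: "finite \<F>" using F(1) finite_subset by blast
  have fin: "finite E" if "E \<in> \<F>" for E using F(1) that finite_subset by blast
  have n: "n \<in> E" if "E \<in> \<A>" for E using that \<A> by (cases "n \<in> E") auto
  define \<S>' where "\<S>' = (\<lambda>E. E - {n}) ` \<S>"
  define \<G> where "\<G> = (\<F> - \<D>) \<union> \<S>'"
  have disj: "\<S>' \<inter> \<F> = {}" using sub(1) by (auto simp: \<S>'_def \<A>)
  have inj: "inj_on (\<lambda>E. E - {n}) \<S>"
    using n sub(1) by (intro inj_onI) (metis insert_Diff subsetD)
  have SB: "t \<le> card ((E - {n}) \<inter> B)" if E: "E \<in> \<S>" and B: "B \<in> \<F> - \<D>" for E B
  proof (cases "B \<in> \<A>")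
    case True
    have "t < card (E \<inter> B)" using ncrit E B True by auto
    moreover have "(E - {n}) \<inter> B = (E \<inter> B) - {n}" "n \<in> E \<inter> B" using n True E sub by auto
    moreover have "finite (E \<inter> B)" using fin B by auto
    ultimately show ?thesis by (simp add: card_Diff_singleton)
  next
    case False
    \<comment> \<open>Removing n from B or from E leaves the same intersection, and here B without n
      is itself a member.\<close>
    then have "B - {n} \<in> \<F>" using B by (simp add: \<A>)
    then have "t \<le> card (E \<inter> (B - {n}))"
      using F(2) E sub(1) by (auto simp: t_intersecting_def \<A>)
    moreover have "E \<inter> (B - {n}) = (E - {n}) \<inter> B" by auto
    ultimately show ?thesis by simp
  qed
  have SS: "t \<le> card ((E - {n}) \<inter> (E' - {n}))" if E: "E \<in> \<S>" and E': "E' \<in> \<S>" for E E'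
  proof -
    have "E' \<in> \<A> - \<D>" using E' sub by blast
    then have "t < card (E \<inter> E')" using ncrit E by blast
    moreover have "(E - {n}) \<inter> (E' - {n}) = (E \<inter> E') - {n}" "n \<in> E \<inter> E'"
      using n E E' sub by auto
    moreover have "finite (E \<inter> E')" using fin E sub(1) by (auto simp: \<A>)
    ultimately show ?thesis by (simp add: card_Diff_singleton)
  qed
  have "t_intersecting t \<G>"
    unfolding t_intersecting_def
  proof (intro ballI)
    fix A B assume "A \<in> \<G>" "B \<in> \<G>"
    then consider "A \<in> \<F> - \<D>" "B \<in> \<F> - \<D>"
      | E where "E \<in> \<S>" "A = E - {n}" "B \<in> \<F> - \<D>"
      | E where "E \<in> \<S>" "B = E - {n}" "A \<in> \<F> - \<D>"
      | E E' where "E \<in> \<S>" "A = E - {n}" "E' \<in> \<S>" "B = E' - {n}"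
      unfolding \<G>_def \<S>'_def by blast
    then show "t \<le> card (A \<inter> B)"
    proof cases
      case 1
      then show ?thesis using F(2) by (auto simp: t_intersecting_def)
    next
      case 2
      then show ?thesis using SB by simp
    next
      case 3
      then show ?thesis using SB[of E A] by (simp add: Int_commute)
    next
      case 4
      then show ?thesis using SS by simp
    qed
  qed
  moreover have "\<G> \<subseteq> Pow {1..n}"
    using F(1) sub(1) unfolding \<G>_def \<S>'_def \<A> by fast
  ultimately have "p_measure n p \<G> \<le> p_measure n p \<F>"
    using opt by (auto simp: optimal_def t_families_def)
  moreover have "p_measure n p \<G> = sum ?w (\<F> - \<D>) + sum ?w \<S>'"
    unfolding p_measure_def \<G>_def using disj finF sub(1)
    by (intro sum.union_disjoint) (auto simp: \<S>'_def \<A> intro: finite_subset[of \<S> \<F>])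
  moreover have "p_measure n p \<F> = sum ?w (\<F> - \<D>) + sum ?w \<D>"
    unfolding p_measure_def using finF sub(2) by (intro sum.subset_diff) (auto simp: \<A>)
  ultimately have le: "sum ?w \<S>' \<le> sum ?w \<D>" by simp
  \<comment> \<open>Dropping n multiplies a weight by (1 - p) / p; this turns the comparison of
    measures into the claimed inequality.\<close>
  have "p * sum ?w \<S>' = (\<Sum>E\<in>\<S>. p * ?w (E - {n}))"
    unfolding \<S>'_def sum.reindex[OF inj] o_def by (simp add: sum_distrib_left)
  also have "\<dots> = (\<Sum>E\<in>\<S>. (1 - p) * ?w E)"
  proof (rule sum.cong)
    fix E assume E: "E \<in> \<S>"
    then have EA: "E \<in> \<A>" using sub(1) by blast
    then have "E \<in> \<F>" by (simp add: \<A>)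
    then have "E \<subseteq> {1..n}" "n \<in> E" "finite E" using F(1) n[OF EA] fin by blast+
    then have "card E \<le> n" "0 < card E" using card_mono[of "{1..n}" E] by (auto simp: card_gt_0_iff)
    then obtain k where k: "card E = Suc k" "k < n" using gr0_implies_Suc by fastforce
    then have "card (E - {n}) = k" using \<open>n \<in> E\<close> by (simp add: card_Diff_singleton)
    moreover have "n - k = Suc (n - Suc k)" using k(2) by simp
    ultimately show "p * ?w (E - {n}) = (1 - p) * ?w E" using k(1) by simp
  qed simp
  also have "\<dots> = (1 - p) * sum ?w \<S>" by (simp add: sum_distrib_left)
  finally have "p * sum ?w \<S>' = (1 - p) * sum ?w \<S>" .
  moreover have "p * sum ?w \<S>' \<le> p * sum ?w \<D>" using le p(1) by (intro mult_left_mono) auto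
  ultimately show ?thesis by linarith
qed

text \<open>\<open>\<A>\<close> collects the members to which n is essential. Two of them that meet
  in only t points must cover {1..n}, so their sizes add up to n + t. Exchanging the size classes i
  and n + t - i against each other in both directions contradicts p < 1 - p, unless i = n + t - i.
  Once all sizes agree, exchanging the members that avoid a point x < n for those that contain it,
  and averaging over x, bounds the number of missing points.\<close>

lemma optimal_generators:
  assumes p: "0 < p" "p < 1/2" and opt: "optimal n p (t_families n t) \<F>"
    and sh: "shifted \<F>" and "1 \<le> n" "1 \<le> t"
    and E0: "E0 \<in> \<F>" "E0 - {n} \<notin> \<F>"
  shows "\<exists>i\<le>n. 2 * i = n + t \<and> real (n - i) \<le> p * (real n - 1)"
proof -
  let ?q = "1 - p"
  let ?w = "\<lambda>E::nat set. p ^ card E * ?q ^ (n - card E)"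
  have F: "\<F> \<subseteq> Pow {1..n}" "t_intersecting t \<F>"
    using opt by (auto simp: optimal_def t_families_def)
  have finF: "finite \<F>" using F(1) finite_subset by blast
  define \<A> where "\<A> = {E \<in> \<F>. E - {n} \<notin> \<F>}"
  have finA: "finite \<A>" using finF by (simp add: \<A>_def)
  have A: "E \<subseteq> {1..n}" "finite E" "n \<in> E" if "E \<in> \<A>" for E
  proof -
    show "E \<subseteq> {1..n}" using that F(1) by (auto simp: \<A>_def)
    then show "finite E" using finite_subset by auto
    show "n \<in> E" using that by (cases "n \<in> E") (auto simp: \<A>_def)
  qed
  have cardn: "card E \<le> n" if "E \<in> \<A>" for E using A(1)[OF that] card_mono[of "{1..n}" E] by simp
  have exch: "?q * sum ?w \<S> \<le> p * sum ?w \<D>"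
    if "\<S> \<subseteq> \<A>" "\<D> \<subseteq> \<A>" "\<S> \<inter> \<D> = {}"
      "\<And>E E'. E \<in> \<S> \<Longrightarrow> E' \<in> \<A> - \<D> \<Longrightarrow> t < card (E \<inter> E')" for \<S> \<D>
    by (rule optimal_exchange[OF _ _ opt \<A>_def that]) (use p in auto)
  have crit: "card E + card E' = n + t \<and> E \<union> E' = {1..n}"
    if E: "E \<in> \<A>" "E' \<in> \<A>" "\<not> t < card (E \<inter> E')" for E E'
  proof -
    have t: "card (E \<inter> E') = t" using E F(2) by (force simp: t_intersecting_def \<A>_def)
    have "x \<in> E \<union> E'" if x: "x \<in> {1..n}" for x
    proof (rule ccontr)
      assume nx: "x \<notin> E \<union> E'"
      then have "x < n" using x A(3)[OF E(1)] by (metis UnCI atLeastAtMost_iff le_neq_implies_less)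
      \<comment> \<open>Trading n for x in E costs the common point n and gains nothing, because x
        is not in E', so the intersection falls below t.\<close>
      then have "insert x (E - {n}) \<in> \<F>"
        using sh x nx E(1) A(3)[OF E(1)] by (auto simp: shifted_def \<A>_def)
      then have "t \<le> card (insert x (E - {n}) \<inter> E')"
        using F(2) E(2) by (auto simp: t_intersecting_def \<A>_def)
      also have "insert x (E - {n}) \<inter> E' = (E \<inter> E') - {n}" using nx by auto
      also have "card \<dots> < t"
        using t A[OF E(1)] A[OF E(2)] \<open>1 \<le> t\<close> by (simp add: card_Diff_singleton)
      finally show False by simp
    qed
    then have U: "E \<union> E' = {1..n}" using A(1)[OF E(1)] A(1)[OF E(2)] by blast
    have "card E + card E' = card (E \<union> E') + card (E \<inter> E')"
      using A(2) E by (intro card_Un_Int) auto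
    then show ?thesis using t U by simp
  qed
  have size: "2 * card E = n + t" if E: "E \<in> \<A>" for E
  proof (rule ccontr)
    assume ne: "2 * card E \<noteq> n + t"
    define cls where "cls i = {E \<in> \<A>. card E = i}" for i
    define j where "j = n + t - card E"
    have j: "card E + j = n + t" "card E \<noteq> j" using ne cardn[OF E] by (auto simp: j_def)
    \<comment> \<open>A critical partner of a set of size i has size j, so after discarding the
      class j the whole class i may drop n.\<close>
    have le: "?q * sum ?w (cls i) \<le> p * sum ?w (cls j)" if "i + j = n + t" "i \<noteq> j" for i j
      by (rule exch) (use crit that in \<open>force simp: cls_def\<close>)+
    have "?q * sum ?w (cls (card E)) \<le> p * sum ?w (cls j)"
      "?q * sum ?w (cls j) \<le> p * sum ?w (cls (card E))" using le j by auto
    moreover have "0 < sum ?w (cls (card E))"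
      using E finA p by (intro sum_pos) (auto simp: cls_def)
    moreover have "0 \<le> sum ?w (cls j)" using p by (intro sum_nonneg) auto
    moreover have "p * sum ?w (cls (card E)) < ?q * sum ?w (cls (card E))"
      using p calculation(3) by (intro mult_strict_right_mono) auto
    moreover have "p * sum ?w (cls j) \<le> ?q * sum ?w (cls j)"
      using p calculation(4) by (intro mult_right_mono) auto
    ultimately show False by linarith
  qed
  have E0: "E0 \<in> \<A>" using E0 by (simp add: \<A>_def)
  define i where "i = card E0"
  have ci: "card E = i" if "E \<in> \<A>" for E using size[OF that] size[OF E0] by (simp add: i_def)
  define c where "c = p ^ i * ?q ^ (n - i)"
  have c: "0 < c" using p by (simp add: c_def)
  have W: "sum ?w \<S> = real (card \<S>) * c" if "\<S> \<subseteq> \<A>" for \<S>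
  proof -
    have "sum ?w \<S> = (\<Sum>E\<in>\<S>. c)" by (rule sum.cong) (use ci that in \<open>auto simp: c_def\<close>)
    then show ?thesis by simp
  qed
  have star: "real (card {E \<in> \<A>. x \<notin> E}) \<le> p * real (card \<A>)" if x: "x \<in> {1..n} - {n}" for x
  proof -
    have "?q * sum ?w {E \<in> \<A>. x \<notin> E} \<le> p * sum ?w {E \<in> \<A>. x \<in> E}"
    proof (rule exch)
      fix E E' assume "E \<in> {E \<in> \<A>. x \<notin> E}" "E' \<in> \<A> - {E \<in> \<A>. x \<in> E}"
      then have "E \<in> \<A>" "E' \<in> \<A>" "x \<notin> E \<union> E'" by auto
      then show "t < card (E \<inter> E')" using crit x by blast
    qed auto
    moreover have "sum ?w {E \<in> \<A>. x \<notin> E} = real (card {E \<in> \<A>. x \<notin> E}) * c"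
      "sum ?w {E \<in> \<A>. x \<in> E} = real (card {E \<in> \<A>. x \<in> E}) * c" by (rule W; blast)+
    ultimately have "c * (?q * real (card {E \<in> \<A>. x \<notin> E})) \<le> c * (p * real (card {E \<in> \<A>. x \<in> E}))"
      by (simp add: algebra_simps)
    then have "?q * real (card {E \<in> \<A>. x \<notin> E}) \<le> p * real (card {E \<in> \<A>. x \<in> E})"
      using c by simp
    moreover have "card \<A> = card {E \<in> \<A>. x \<notin> E} + card {E \<in> \<A>. x \<in> E}"
    proof -
      have "card ({E \<in> \<A>. x \<notin> E} \<union> {E \<in> \<A>. x \<in> E}) = card {E \<in> \<A>. x \<notin> E} + card {E \<in> \<A>. x \<in> E}"
        using finA by (intro card_Un_disjoint) auto
      moreover have "{E \<in> \<A>. x \<notin> E} \<union> {E \<in> \<A>. x \<in> E} = \<A>" by auto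
      ultimately show ?thesis by simp
    qed
    ultimately show ?thesis by (simp add: algebra_simps)
  qed
  \<comment> \<open>Double counting of the pairs (E, x) with x missing from E. The point n lies in
    every E, so only n - 1 points take part.\<close>
  have "real (card \<A>) * real (n - i) = (\<Sum>E\<in>\<A>. real (card ({1..n} - E)))"
  proof -
    have "card ({1..n} - E) = n - i" if "E \<in> \<A>" for E
      using A[OF that] ci[OF that] by (simp add: card_Diff_subset)
    then show ?thesis by simp
  qed
  also have "\<dots> = (\<Sum>E\<in>\<A>. \<Sum>x\<in>{1..n} - {n}. if x \<notin> E then 1 else 0)"
  proof (rule sum.cong)
    fix E assume "E \<in> \<A>"
    then have "{1..n} - E = {x \<in> {1..n} - {n}. x \<notin> E}" using A(3) by auto
    then show "real (card ({1..n} - E)) = (\<Sum>x\<in>{1..n} - {n}. if x \<notin> E then 1 else 0)"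
      by (simp add: sum.If_cases Int_def)
  qed simp
  also have "\<dots> = (\<Sum>x\<in>{1..n} - {n}. \<Sum>E\<in>\<A>. if x \<notin> E then 1 else 0)" by (rule sum.swap)
  also have "\<dots> = (\<Sum>x\<in>{1..n} - {n}. real (card {E \<in> \<A>. x \<notin> E}))"
    using finA by (simp add: sum.If_cases Int_def)
  also have "\<dots> \<le> (\<Sum>x\<in>{1..n} - {n}. p * real (card \<A>))" by (intro sum_mono star)
  also have "\<dots> = (real n - 1) * (p * real (card \<A>))" using \<open>1 \<le> n\<close> by simp
  finally have "real (card \<A>) * real (n - i) \<le> real (card \<A>) * (p * (real n - 1))"
    by (simp add: algebra_simps)
  moreover have "0 < card \<A>" using E0 finA card_gt_0_iff by blast
  ultimately have "real (n - i) \<le> p * (real n - 1)" by simp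
  then show ?thesis using size[OF E0] cardn[OF E0] i_def by blast
qed

text \<open>m is the last element that matters for membership. If the last element of the ground set
  is inessential, the family is a cylinder over its restriction, which is again optimal and shifted,
  and the induction continues there; otherwise \<open>optimal_generators\<close> applies. The
  alternative m = 0 stands for families in which no element matters.\<close>

lemma optimal_determined:
  assumes p: "0 < p" "p < 1/2" and "1 \<le> t"
  shows "optimal n p (t_families n t) \<F> \<Longrightarrow> shifted \<F> \<Longrightarrow>
    \<exists>m\<le>n. (\<forall>A\<subseteq>{1..n}. A \<in> \<F> \<longleftrightarrow> A \<inter> {1..m} \<in> \<F>) \<and>
      (m = 0 \<or> (\<exists>i\<le>m. 2 * i = m + t \<and> real (m - i) \<le> p * (real m - 1)))"
proof (induction n arbitrary: \<F>)
  case 0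
  then show ?case by auto
next
  case (Suc n)
  have F: "\<F> \<subseteq> Pow {1..Suc n}" "t_intersecting t \<F>"
    using Suc.prems by (auto simp: optimal_def t_families_def)
  have up: "up_closed (Suc n) \<F>"
    using optimal_up_closed[OF shift_class_t_families Suc.prems(1)] p by simp
  show ?case
  proof (cases "\<exists>E\<in>\<F>. E - {Suc n} \<notin> \<F>")
    case True
    then obtain E where "E \<in> \<F>" "E - {Suc n} \<notin> \<F>" by blast
    then have "\<exists>i\<le>Suc n. 2 * i = Suc n + t \<and> real (Suc n - i) \<le> p * (real (Suc n) - 1)"
      using optimal_generators[OF p Suc.prems(1,2)] \<open>1 \<le> t\<close> by simp
    moreover have "A \<inter> {1..Suc n} = A" if "A \<subseteq> {1..Suc n}" for A using that by blast
    ultimately show ?thesis by (intro exI[of _ "Suc n"]) simp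
  next
    case False
    define \<K> where "\<K> = \<F> \<inter> Pow {1..n}"
    have det: "A \<in> \<F> \<longleftrightarrow> A \<inter> {1..n} \<in> \<K>" if "A \<subseteq> {1..Suc n}" for A
    proof -
      have "A \<inter> {1..n} = A - {Suc n}" using that by (auto simp: le_Suc_eq)
      moreover have "A - {Suc n} \<in> \<F> \<Longrightarrow> A \<in> \<F>"
        using up that by (auto simp: up_closed_def)
      ultimately show ?thesis using False by (auto simp: \<K>_def)
    qed
    have cyl: "\<F> = {A \<in> Pow {1..Suc n}. A \<inter> {1..n} \<in> \<K>}" using det F(1) by auto
    have mK: "p_measure (Suc n) p \<F> = p_measure n p \<K>"
      by (subst cyl, rule p_measure_cylinder) (auto simp: \<K>_def)
    have "p_measure n p \<G> \<le> p_measure n p \<K>" if G: "\<G> \<in> t_families n t" for \<G>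
    proof -
      \<comment> \<open>A competitor on {1..n} is tested against \<open>\<F>\<close> through its
        cylinder, which has the same measure.\<close>
      let ?C = "{A \<in> Pow {1..Suc n}. A \<inter> {1..n} \<in> \<G>}"
      have "t \<le> card (A \<inter> B)" if "A \<in> ?C" "B \<in> ?C" for A B
      proof -
        have "t \<le> card ((A \<inter> {1..n}) \<inter> (B \<inter> {1..n}))"
          using G that by (auto simp: t_families_def t_intersecting_def)
        also have "\<dots> \<le> card (A \<inter> B)"
          using that finite_subset[of A "{1..Suc n}"] by (intro card_mono) auto
        finally show ?thesis .
      qed
      then have "?C \<in> t_families (Suc n) t" by (auto simp: t_families_def t_intersecting_def)
      then have "p_measure (Suc n) p ?C \<le> p_measure (Suc n) p \<F>"
        using Suc.prems(1) by (simp add: optimal_def)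
      moreover have "p_measure (Suc n) p ?C = p_measure n p \<G>"
        using G by (intro p_measure_cylinder) (auto simp: t_families_def)
      ultimately show ?thesis using mK by simp
    qed
    moreover have "\<K> \<in> t_families n t" using F(2) by (auto simp: t_families_def t_intersecting_def \<K>_def)
    ultimately have optK: "optimal n p (t_families n t) \<K>" by (simp add: optimal_def)
    have "shifted \<K>"
      unfolding shifted_def
    proof (intro ballI allI impI)
      fix A i j assume A: "A \<in> \<K>" and ij: "1 \<le> i \<and> i < j \<and> j \<in> A \<and> i \<notin> A"
      then have "A \<subseteq> {1..n}" "A \<in> \<F>" by (auto simp: \<K>_def)
      moreover from this have "j \<le> n" using ij by auto
      ultimately show "insert i (A - {j}) \<in> \<K>"
        using Suc.prems(2) ij by (auto simp: shifted_def \<K>_def)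
    qed
    from Suc.IH[OF optK this] obtain m where m: "m \<le> n"
      "\<And>A. A \<subseteq> {1..n} \<Longrightarrow> A \<in> \<K> \<longleftrightarrow> A \<inter> {1..m} \<in> \<K>"
      "m = 0 \<or> (\<exists>i\<le>m. 2 * i = m + t \<and> real (m - i) \<le> p * (real m - 1))" by blast
    have "A \<in> \<F> \<longleftrightarrow> A \<inter> {1..m} \<in> \<F>" if A: "A \<subseteq> {1..Suc n}" for A
    proof -
      have "A \<in> \<F> \<longleftrightarrow> (A \<inter> {1..n}) \<inter> {1..m} \<in> \<K>" using det[OF A] m(2)[of "A \<inter> {1..n}"] by simp
      also have "(A \<inter> {1..n}) \<inter> {1..m} = A \<inter> {1..m}" using m(1) by auto
      also have "A \<inter> {1..m} \<in> \<K> \<longleftrightarrow> A \<inter> {1..m} \<in> \<F>" using m(1) by (auto simp: \<K>_def)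
      finally show ?thesis .
    qed
    then show ?thesis using m(1,3) by (intro exI[of _ m]) auto
  qed
qed

text \<open>For p < 1/2 the case t = 1 of the generating set argument gives (m - 1) / 2 \<le> p (m -
  1), so only the element 1 can matter. That argument needs strictness; at p = 1/2 the family is
  paired with itself as a cross-intersecting pair instead.\<close>

lemma intersecting_p_measure_le:
  assumes p: "0 < p" "p \<le> 1/2" and "\<F> \<in> t_families n 1"
  shows "p_measure n p \<F> \<le> p"
proof (cases "p = 1/2")
  case True
  have F: "\<F> \<subseteq> Pow {1..n}" "t_intersecting 1 \<F>" using assms(3) by (auto simp: t_families_def)
  have "pm p {1..n} (\<lambda>A. A \<in> \<F>) + pm p {1..n} (\<lambda>A. A \<in> \<F>) \<le> 1"
    by (rule pm_cross_intersecting) (use p F(2) in \<open>force simp: t_intersecting_def\<close>)+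
  then show ?thesis unfolding p_measure_eq_pm[OF F(1)] using True by linarith
next
  case False
  with p have p': "0 < p" "p < 1" "p < 1/2" by auto
  obtain \<G> where G: "optimal n p (t_families n 1) \<G>"
    using optimal_exists[OF shift_class_t_families] assms(3) by blast
  have "p_measure n p \<G> \<le> p"
  proof (rule optimal_shift_induct[OF shift_class_t_families p'(1,2) G])
    fix \<F> assume 1: "optimal n p (t_families n 1) \<F>" "up_closed n \<F>" "shifted \<F>"
    then have F: "\<F> \<subseteq> Pow {1..n}" "t_intersecting 1 \<F>" by (auto simp: optimal_def t_families_def)
    have ne: "{} \<notin> \<F>" using F(2) by (force simp: t_intersecting_def)
    obtain m where m: "m \<le> n" "\<And>A. A \<subseteq> {1..n} \<Longrightarrow> A \<in> \<F> \<longleftrightarrow> A \<inter> {1..m} \<in> \<F>"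
      "m = 0 \<or> (\<exists>i\<le>m. 2 * i = m + 1 \<and> real (m - i) \<le> p * (real m - 1))"
      using optimal_determined[OF p'(1,3) order_refl 1(1,3)] by blast
    have "m \<le> 1"
    proof (rule ccontr)
      assume "\<not> m \<le> 1"
      then obtain i where i: "i \<le> m" "2 * i = m + 1" "real (m - i) \<le> p * (real m - 1)"
        using m(3) by auto
      then have "real (m - i) = (real m - 1) * (1/2)" by (simp add: field_simps)
      then have "(real m - 1) * (1/2) \<le> (real m - 1) * p" using i(3) by (simp add: mult.commute)
      then show False using p'(3) \<open>\<not> m \<le> 1\<close> by simp
    qed
    have mem: "m = 1 \<and> 1 \<in> A" if A: "A \<in> \<F>" for A
    proof -
      have "A \<inter> {1..m} \<noteq> {}" using m(2) F(1) A ne by (metis PowD subsetD)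
      then show ?thesis using \<open>m \<le> 1\<close> by (cases m) auto
    qed
    show "p_measure n p \<F> \<le> p"
    proof (cases "\<F> = {}")
      case True
      then show ?thesis using p by (simp add: p_measure_def)
    next
      case False
      then have "1 \<le> n" using mem m(1) by blast
      let ?S = "{A \<in> Pow {1..n}. A \<inter> {1..1} \<in> {{1}}}"
      have "\<F> \<subseteq> ?S" using F(1) mem by auto
      then have "p_measure n p \<F> \<le> p_measure n p ?S"
        unfolding p_measure_def using p' by (intro sum_mono2) auto
      also have "\<dots> = p_measure 1 p {{1}}" by (rule p_measure_cylinder) (use \<open>1 \<le> n\<close> in auto)
      finally show ?thesis by (simp add: p_measure_def)
    qed
  next
    fix \<F> i j
    assume 2: "optimal n p (t_families n 1) \<F>" "1 \<le> i" "i < j" "j \<le> n"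
      "p_measure n p (shift i j \<F>) \<le> p"
    then have "p_measure n p (shift i j \<F>) = p_measure n p \<F>"
      by (intro p_measure_shift) (auto simp: optimal_def t_families_def)
    then show "p_measure n p \<F> \<le> p" using 2 by simp
  qed
  then show ?thesis using G assms(3) by (force simp: optimal_def)
qed

section \<open>Threshold families\<close>

text \<open>The Frankl families. With card T = 2k - 2, the value k = 2 gives all sets containing a
  fixed pair and k = 3 gives a copy of \<open>BD3\<close>, so both optimal shapes are treated by one
  argument.\<close>

definition threshold :: "nat \<Rightarrow> nat set \<Rightarrow> nat \<Rightarrow> nat set set" where
  "threshold n T k = {A \<in> Pow {1..n}. k \<le> card (A \<inter> T)}"

lemma threshold_t_families:
  assumes "T \<subseteq> {1..n}" "card T + 2 \<le> 2 * k"
  shows "threshold n T k \<in> t_families n 2"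
proof -
  have "2 \<le> card (A \<inter> B)" if "A \<in> threshold n T k" "B \<in> threshold n T k" for A B
  proof -
    have fin: "finite T" "finite A"
      using assms(1) that finite_subset by (auto simp: threshold_def intro: finite_subset)
    have "card (A \<inter> T) + card (B \<inter> T)
        = card ((A \<inter> T) \<union> (B \<inter> T)) + card ((A \<inter> T) \<inter> (B \<inter> T))"
      using fin by (intro card_Un_Int) auto
    moreover have "card ((A \<inter> T) \<union> (B \<inter> T)) \<le> card T" using fin by (intro card_mono) auto
    moreover have "card ((A \<inter> T) \<inter> (B \<inter> T)) \<le> card (A \<inter> B)" using fin by (intro card_mono) auto
    moreover have "k \<le> card (A \<inter> T)" "k \<le> card (B \<inter> T)" using that by (auto simp: threshold_def)
    ultimately show ?thesis using assms(2) by linarith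
  qed
  then show ?thesis by (auto simp: t_families_def t_intersecting_def threshold_def)
qed

text \<open>Provides the intermediate set through which two choices are compared when a shift is
  undone. For k = 2 the sets are single points. For k = 3 one of the three pairs in T differs from
  both P and P', and distinct pairs share at most one point.\<close>

lemma two_subsets_avoid:
  assumes "finite T" "card T = 2 * k - 3" "k = 2 \<or> k = 3"
    and "P \<subseteq> T" "card P = k - 1" "P' \<subseteq> T" "card P' = k - 1"
  obtains Q where "Q \<subseteq> T" "card Q = k - 1" "card (P \<inter> Q) \<le> 1" "card (P' \<inter> Q) \<le> 1"
proof (cases "k = 2")
  case True
  have "card (P \<inter> P) \<le> 1" "card (P' \<inter> P) \<le> 1"
    using True assms card_mono[of P "P' \<inter> P"] finite_subset[of P T] by auto
  then show ?thesis using that[of P] assms by auto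
next
  case False
  then have k: "k = 3" using assms(3) by simp
  then obtain a b c where T: "T = {a, b, c}" "a \<noteq> b" "a \<noteq> c" "b \<noteq> c"
    using assms(2) by (auto simp: card_3_iff)
  have meet: "card (X \<inter> Y) \<le> 1" if "card X = 2" "card Y = 2" "X \<noteq> Y" for X Y :: "'a set"
  proof -
    have fin: "finite X" "finite Y" using that by (auto intro: card_ge_0_finite)
    have "X \<inter> Y \<noteq> X"
    proof
      assume "X \<inter> Y = X"
      then have "X \<subseteq> Y" by blast
      then show False using card_subset_eq[OF fin(2)] that by simp
    qed
    then have "card (X \<inter> Y) < card X" using fin by (intro psubset_card_mono) auto
    then show ?thesis using that by simp
  qed
  have "{a, b} \<noteq> {a, c}" "{a, b} \<noteq> {b, c}" "{a, c} \<noteq> {b, c}" using T by (auto simp: doubleton_eq_iff)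
  then obtain Q where "Q = {a, b} \<or> Q = {a, c} \<or> Q = {b, c}" "Q \<noteq> P" "Q \<noteq> P'" by metis
  moreover from this have "card Q = 2" "Q \<subseteq> T" using T by auto
  ultimately show ?thesis using that[of Q] meet[of P Q] meet[of P' Q] assms k by simp
qed

text \<open>In the only interesting case, \<open>i \<in> T\<close> and \<open>j \<notin> T\<close>, each \<open>B\<close> disjoint from \<open>{i, j}\<close>
  with \<open>card (B \<inter> T) = k - 1\<close> comes from exactly one of \<open>insert i B\<close> and \<open>insert j B\<close>, and
  the choice has to be the same for any two such sets that meet in at most one point.\<close>

lemma shift_eq_threshold:
  assumes F: "\<F> \<in> t_families n 2" and ij: "1 \<le> i" "i < j" "j \<le> n"
    and T: "shift i j \<F> = threshold n T k" "T \<subseteq> {1..n}" "card T = 2 * k - 2"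
    and k: "k = 2 \<or> k = 3"
  shows "\<exists>T'\<subseteq>{1..n}. card T' = 2 * k - 2 \<and> \<F> = threshold n T' k"
proof -
  have Fn: "\<F> \<subseteq> Pow {1..n}" "t_intersecting 2 \<F>" using F by (auto simp: t_families_def)
  have finT: "finite T" using T(2) finite_subset by auto
  have mem: "A \<in> shift i j \<F> \<longleftrightarrow> A \<subseteq> {1..n} \<and> k \<le> card (A \<inter> T)" for A
    using T(1) by (auto simp: threshold_def)
  have eqI: "\<F> = threshold n T' k"
    if "\<And>A. A \<subseteq> {1..n} \<Longrightarrow> A \<in> \<F> \<longleftrightarrow> k \<le> card (A \<inter> T')" for T'
    using that Fn(1) by (auto simp: threshold_def)
  have same: "A \<in> \<F> \<longleftrightarrow> k \<le> card (A \<inter> T)" if "A \<subseteq> {1..n}" "i \<in> A \<longleftrightarrow> j \<in> A" for A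
    using mem[of A] that by (auto simp: shift_def split: if_splits)
  have both: "(insert i B \<in> \<F> \<or> insert j B \<in> \<F> \<longleftrightarrow> k \<le> card (insert i B \<inter> T))
      \<and> (insert i B \<in> \<F> \<and> insert j B \<in> \<F> \<longleftrightarrow> k \<le> card (insert j B \<inter> T))"
    if B: "B \<subseteq> {1..n} - {i, j}" for B
  proof -
    have "insert i B \<subseteq> {1..n}" "insert j B \<subseteq> {1..n}" using B ij by auto
    moreover have "i \<notin> B" "j \<notin> B" using B by auto
    moreover from this have "swap i j (insert i B) = insert j B" "swap i j (insert j B) = insert i B"
      using ij by (auto simp: swap_left swap_right)
    ultimately show ?thesis
      using mem[of "insert i B"] mem[of "insert j B"] ij by (auto simp: shift_def split: if_splits)
  qed
  have caseB: "A \<subseteq> {1..n} \<Longrightarrow> (i \<in> A \<longleftrightarrow> j \<in> A) \<or>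
      (\<exists>B\<subseteq>{1..n} - {i, j}. A = insert i B \<or> A = insert j B)" for A
  proof (cases "i \<in> A \<longleftrightarrow> j \<in> A")
    case False
    assume "A \<subseteq> {1..n}"
    then have "A - {i, j} \<subseteq> {1..n} - {i, j}" by auto
    moreover have "A = insert i (A - {i, j}) \<or> A = insert j (A - {i, j})" using False by auto
    ultimately show ?thesis by blast
  qed auto
  consider "i \<in> T \<longleftrightarrow> j \<in> T" | "i \<notin> T" "j \<in> T" | "i \<in> T" "j \<notin> T" by blast
  then show ?thesis
  proof cases
    case 1
    have "card (insert i B \<inter> T) = card (insert j B \<inter> T)" if "B \<subseteq> {1..n} - {i, j}" for B
    proof -
      have "i \<notin> B" "j \<notin> B" using that by auto
      then show ?thesis using 1 finT by (simp add: Int_insert_left)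
    qed
    then have "\<F> = threshold n T k"
      using same both caseB by (intro eqI) metis
    then show ?thesis using T by blast
  next
    case 2
    \<comment> \<open>This case is impossible: the shift favours i, while a threshold set containing
      j but not i favours j. A set P with k - 1 points of T besides j exhibits the conflict.\<close>
    have "k - 1 \<le> card (T - {j})" using 2 finT T(3) k by (auto simp: card_Diff_singleton)
    then obtain P where P: "P \<subseteq> T - {j}" "card P = k - 1" by (metis obtain_subset_with_card_n)
    have fP: "finite P" using P finT finite_subset[of P T] by auto
    have "P \<subseteq> {1..n} - {i, j}" using P T(2) 2 by auto
    moreover have "card (insert j P \<inter> T) = k"
    proof -
      have "insert j P \<inter> T = insert j P" "j \<notin> P" using P 2 by auto
      then show ?thesis using P fP k by auto
    qed
    moreover have "card (insert i P \<inter> T) = k - 1"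
    proof -
      have "insert i P \<inter> T = P" using P 2 by auto
      then show ?thesis using P by simp
    qed
    ultimately show ?thesis using both[of P] k by auto
  next
    case 3
    define T0 where "T0 = T - {i}"
    have T0: "finite T0" "card T0 = 2 * k - 3" "T0 \<subseteq> {1..n} - {i, j}"
      using T 3 finT by (auto simp: T0_def card_Diff_singleton)
    have ci: "card (insert i B \<inter> T) = Suc (card (B \<inter> T0))"
      and cj: "card (insert j B \<inter> T) = card (B \<inter> T0)"
      and cj': "card (insert j B \<inter> insert j T0) = Suc (card (B \<inter> T0))"
      and ci': "card (insert i B \<inter> insert j T0) = card (B \<inter> T0)" if B: "B \<subseteq> {1..n} - {i, j}" for B
    proof -
      have "i \<notin> B" "j \<notin> B" using B by auto
      then have "insert i B \<inter> T = insert i (B \<inter> T0)" "insert j B \<inter> T = B \<inter> T0"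
        "insert j B \<inter> insert j T0 = insert j (B \<inter> T0)" "insert i B \<inter> insert j T0 = B \<inter> T0"
        using 3 ij by (auto simp: T0_def)
      then show "card (insert i B \<inter> T) = Suc (card (B \<inter> T0))"
        "card (insert j B \<inter> T) = card (B \<inter> T0)"
        "card (insert j B \<inter> insert j T0) = Suc (card (B \<inter> T0))"
        "card (insert i B \<inter> insert j T0) = card (B \<inter> T0)"
        using \<open>i \<notin> B\<close> \<open>j \<notin> B\<close> T0(1) by simp_all
    qed
    define ok where "ok B \<longleftrightarrow> B \<subseteq> {1..n} - {i, j} \<and> card (B \<inter> T0) = k - 1" for B
    have excl: "insert i B \<in> \<F> \<longleftrightarrow> insert j B \<notin> \<F>" if "ok B" for B
      using both[of B] ci[of B] cj[of B] that k by (auto simp: ok_def)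
    have link: "insert i B \<in> \<F> \<longleftrightarrow> insert i B' \<in> \<F>" if "ok B" "ok B'" "card (B \<inter> B') \<le> 1" for B B'
    proof -
      have False if "ok B" "ok B'" "insert i B \<in> \<F>" "insert j B' \<in> \<F>" "card (B \<inter> B') \<le> 1" for B B'
      proof -
        have "2 \<le> card (insert i B \<inter> insert j B')" using that Fn(2) by (auto simp: t_intersecting_def)
        moreover have "insert i B \<inter> insert j B' = B \<inter> B'" using that ij by (auto simp: ok_def)
        ultimately show False using that by simp
      qed
      then show ?thesis using that excl by (metis Int_commute)
    qed
    \<comment> \<open>B and B' may share many points, but both can be compared with a set Q inside
      \<open>T0\<close> that meets each of them at most once.\<close>
    have all: "insert i B \<in> \<F> \<longleftrightarrow> insert i B' \<in> \<F>" if B: "ok B" "ok B'" for B B'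
    proof -
      obtain Q where Q: "Q \<subseteq> T0" "card Q = k - 1"
        "card ((B \<inter> T0) \<inter> Q) \<le> 1" "card ((B' \<inter> T0) \<inter> Q) \<le> 1"
        using two_subsets_avoid[OF T0(1,2) k, of "B \<inter> T0" "B' \<inter> T0"] B by (auto simp: ok_def)
      have "ok Q" "B \<inter> Q = (B \<inter> T0) \<inter> Q" "B' \<inter> Q = (B' \<inter> T0) \<inter> Q"
        using Q T0(3) by (auto simp: ok_def Int_absorb2)
      then show ?thesis using link B Q by metis
    qed
    show ?thesis
    proof (cases "\<exists>B. ok B \<and> insert i B \<in> \<F>")
      case True
      then have io: "insert i B \<in> \<F>" if "ok B" for B using all that by blast
      have "insert i B \<in> \<F> \<longleftrightarrow> k \<le> card (insert i B \<inter> T)"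
        "insert j B \<in> \<F> \<longleftrightarrow> k \<le> card (insert j B \<inter> T)" if B: "B \<subseteq> {1..n} - {i, j}" for B
        using both[OF B] ci[OF B] cj[OF B] io[of B] excl[of B] B k unfolding ok_def by fastforce+
      then have "\<F> = threshold n T k" using same caseB by (intro eqI) metis
      then show ?thesis using T by blast
    next
      case False
      \<comment> \<open>Now j was chosen throughout, so undoing the shift replaces i by j in
        T.\<close>
      let ?T' = "insert j T0"
      have "insert i B \<in> \<F> \<longleftrightarrow> k \<le> card (insert i B \<inter> ?T')"
        "insert j B \<in> \<F> \<longleftrightarrow> k \<le> card (insert j B \<inter> ?T')" if B: "B \<subseteq> {1..n} - {i, j}" for B
        using both[OF B] ci[OF B] cj[OF B] ci'[OF B] cj'[OF B] False excl[of B] B k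
        unfolding ok_def by fastforce+
      moreover have "card (A \<inter> T) = card (A \<inter> ?T')" if "i \<in> A \<longleftrightarrow> j \<in> A" for A
      proof -
        have "A \<inter> T = (if i \<in> A then insert i (A \<inter> T0) else A \<inter> T0)"
          "A \<inter> ?T' = (if i \<in> A then insert j (A \<inter> T0) else A \<inter> T0)"
          using that 3 by (auto simp: T0_def)
        moreover have "i \<notin> T0" "j \<notin> T0" using 3 by (auto simp: T0_def)
        ultimately show ?thesis using T0(1) by simp
      qed
      ultimately have "\<F> = threshold n ?T' k" using same caseB by (intro eqI) metis
      moreover have "card ?T' = 2 * k - 2" "?T' \<subseteq> {1..n}" using T0 3 ij k by (auto simp: T0_def)
      ultimately show ?thesis by blast
    qed
  qed
qed

lemma optimal_eq_threshold:
  assumes "shift_class n \<C>" "optimal n p \<C> \<F>" "0 < p" "p < 1" "threshold n T k \<in> \<C>"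
    and "\<F> \<subseteq> threshold n T k"
  shows "\<F> = threshold n T k"
proof (rule ccontr)
  assume "\<F> \<noteq> threshold n T k"
  then have "p_measure n p \<F> < p_measure n p (threshold n T k)"
    using assms by (intro p_measure_psubset) (auto simp: threshold_def)
  then show False using assms(2,5) by (force simp: optimal_def)
qed

lemma shifted_pairs:
  assumes sh: "shifted \<F>" and R: "R \<subseteq> {5..n}"
  shows "{3, 4} \<union> R \<in> \<F> \<Longrightarrow> {2, 4} \<union> R \<in> \<F>"
    "{2, 4} \<union> R \<in> \<F> \<Longrightarrow> {2, 3} \<union> R \<in> \<F>"
    "{2, 4} \<union> R \<in> \<F> \<Longrightarrow> {1, 4} \<union> R \<in> \<F>"
    "{2, 3} \<union> R \<in> \<F> \<Longrightarrow> {1, 3} \<union> R \<in> \<F>"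
    "{1, 4} \<union> R \<in> \<F> \<Longrightarrow> {1, 3} \<union> R \<in> \<F>"
    "{1, 3} \<union> R \<in> \<F> \<Longrightarrow> {1, 2} \<union> R \<in> \<F>"
    "{2, 3, 4} \<union> R \<in> \<F> \<Longrightarrow> {1, 3, 4} \<union> R \<in> \<F>"
proof -
  have step: "I' \<union> R \<in> \<F>"
    if "I \<union> R \<in> \<F>" "1 \<le> i" "i < j" "j \<in> I" "i \<notin> I" "j \<le> 4" "insert i (I - {j}) = I'" for i j I I'
  proof -
    have "i \<notin> R" "j \<notin> R" using R that by auto
    then have "insert i ((I \<union> R) - {j}) \<in> \<F>" using sh that by (auto simp: shifted_def)
    moreover have "insert i ((I \<union> R) - {j}) = I' \<union> R"
      unfolding that(7)[symmetric] using \<open>j \<notin> R\<close> by blast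
    ultimately show ?thesis by simp
  qed
  show "{3, 4} \<union> R \<in> \<F> \<Longrightarrow> {2, 4} \<union> R \<in> \<F>" by (erule step[where i = 2 and j = 3]) auto
  show "{2, 4} \<union> R \<in> \<F> \<Longrightarrow> {2, 3} \<union> R \<in> \<F>" by (erule step[where i = 3 and j = 4]) auto
  show "{2, 4} \<union> R \<in> \<F> \<Longrightarrow> {1, 4} \<union> R \<in> \<F>" by (erule step[where i = 1 and j = 2]) auto
  show "{2, 3} \<union> R \<in> \<F> \<Longrightarrow> {1, 3} \<union> R \<in> \<F>" by (erule step[where i = 1 and j = 2]) auto
  show "{1, 4} \<union> R \<in> \<F> \<Longrightarrow> {1, 3} \<union> R \<in> \<F>" by (erule step[where i = 3 and j = 4]) auto
  show "{1, 3} \<union> R \<in> \<F> \<Longrightarrow> {1, 2} \<union> R \<in> \<F>" by (erule step[where i = 2 and j = 3]) auto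
  show "{2, 3, 4} \<union> R \<in> \<F> \<Longrightarrow> {1, 3, 4} \<union> R \<in> \<F>" by (erule step[where i = 1 and j = 2]) auto
qed

text \<open>By up-closure the trace grows to a pair, and every pair in {1..4} can be shifted to {1,
  2}. This turns a member outside \<open>BD3\<close> into concrete information about the trace {1,
  2}.\<close>

lemma shifted_small_trace:
  assumes up: "up_closed n \<F>" and sh: "shifted \<F>" and n: "4 \<le> n" and R: "R \<subseteq> {5..n}"
    and I: "I \<subseteq> {1..4}" "card I \<le> 2" "I \<union> R \<in> \<F>"
  shows "{1, 2} \<union> R \<in> \<F>"
proof -
  have sup: "J \<union> R \<in> \<F>" if "I \<subseteq> J" "J \<subseteq> {1..4}" for J
  proof -
    have "J \<union> R \<subseteq> {1..n}" using that R n by fastforce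
    then show ?thesis using up I(3) that(1) unfolding up_closed_def by (meson Un_mono order_refl)
  qed
  have "I \<in> Pow {1, 2, 3, 4}" using I(1) by force
  then have "I \<subseteq> {1,2} \<or> I \<subseteq> {1,3} \<or> I \<subseteq> {1,4} \<or> I \<subseteq> {2,3} \<or> I \<subseteq> {2,4} \<or> I \<subseteq> {3,4}"
    using I(2) by (auto simp: Pow_insert)
  then have "{1,2} \<union> R \<in> \<F> \<or> {1,3} \<union> R \<in> \<F> \<or> {1,4} \<union> R \<in> \<F> \<or> {2,3} \<union> R \<in> \<F> \<or>
      {2,4} \<union> R \<in> \<F> \<or> {3,4} \<union> R \<in> \<F>"
    using sup[of "{1,2}"] sup[of "{1,3}"] sup[of "{1,4}"] sup[of "{2,3}"] sup[of "{2,4}"]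
      sup[of "{3,4}"] by auto
  then show ?thesis using shifted_pairs[OF sh R] by blast
qed

lemma optimal_shifted_small_p:
  assumes p: "0 < p" "p < 2/5" and n: "4 \<le> n" and opt: "optimal n p (t_families n 2) \<F>"
    and sh: "shifted \<F>"
  shows "\<F> = threshold n {1..2} 2 \<or> \<F> = threshold n {1..4} 3"
proof -
  have F: "\<F> \<subseteq> Pow {1..n}" "t_intersecting 2 \<F>"
    using opt by (auto simp: optimal_def t_families_def)
  have up: "up_closed n \<F>" using optimal_up_closed[OF shift_class_t_families opt] p by simp
  obtain m where m: "m \<le> n" "\<And>A. A \<subseteq> {1..n} \<Longrightarrow> A \<in> \<F> \<longleftrightarrow> A \<inter> {1..m} \<in> \<F>"
    "m = 0 \<or> (\<exists>i\<le>m. 2 * i = m + 2 \<and> real (m - i) \<le> p * (real m - 1))"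
    using optimal_determined[of p 2 n \<F>] p opt sh by auto
  have "m \<le> 4"
  proof (rule ccontr)
    assume m4: "\<not> m \<le> 4"
    then obtain i where i: "i \<le> m" "2 * i = m + 2" "real (m - i) \<le> p * (real m - 1)"
      using m(3) by auto
    \<comment> \<open>The relation 2i = m + 2 makes m even. At m = 6 the bound (m - 2) / 2 \<le> p
      (m - 1) reads 2 \<le> 5p, which is where 2/5 appears.\<close>
    then have "6 \<le> m" using m4 by presburger
    have "real (m - i) = (real m - 2) / 2" using i by (simp add: field_simps)
    moreover have "p * (real m - 1) < 2/5 * (real m - 1)"
      using p \<open>6 \<le> m\<close> by (intro mult_strict_right_mono) auto
    ultimately show False using i(3) \<open>6 \<le> m\<close> by simp
  qed
  have tr: "A \<inter> {1..4} \<in> \<F>" if "A \<in> \<F>" for A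
  proof -
    have A: "A \<subseteq> {1..n}" using that F(1) by blast
    have "(A \<inter> {1..4}) \<inter> {1..m} = A \<inter> {1..m}" using \<open>m \<le> 4\<close> by auto
    then show ?thesis using m(2)[OF A] m(2)[of "A \<inter> {1..4}"] A that by auto
  qed
  have "\<F> \<subseteq> threshold n {1..2} 2 \<or> \<F> \<subseteq> threshold n {1..4} 3"
  proof (cases "{1, 2} \<in> \<F>")
    case True
    have "{1..2} = {1, 2::nat}" by auto
    then have "2 \<le> card (A \<inter> {1..2})" if "A \<in> \<F>" for A
      using F(2) True that by (auto simp: t_intersecting_def)
    then show ?thesis using F(1) by (auto simp: threshold_def)
  next
    case False
    have "3 \<le> card (A \<inter> {1..4})" if "A \<in> \<F>" for A
    proof (rule ccontr)
      assume "\<not> 3 \<le> card (A \<inter> {1..4})"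
      then have "{1, 2} \<union> {} \<in> \<F>"
        using tr[OF that] by (intro shifted_small_trace[OF up sh n, of _ "A \<inter> {1..4}"]) auto
      then show False using False by simp
    qed
    then show ?thesis using F(1) by (auto simp: threshold_def)
  qed
  moreover have "threshold n {1..2} 2 \<in> t_families n 2" "threshold n {1..4} 3 \<in> t_families n 2"
    using n by (intro threshold_t_families; simp)+
  ultimately show ?thesis
    using optimal_eq_threshold[OF shift_class_t_families opt] p by auto
qed

section \<open>Walks\<close>

text \<open>Induction on the size of the common intersection. Suppose no prefix holds more than 2j
  incidences, and let x be the least common point. As x alone contributes 3, some earlier y lies in
  at most one of the sets. Replacing x by y in a set that omits y removes x from the intersection,
  and y does not enter it because another set omits y too. Prefix counts grow only for y \<le> j <
  x, where one unit of slack is available. The sets are indexed because they may coincide.\<close>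

lemma shifted_three_wise_prefix:
  fixes A :: "nat \<Rightarrow> nat set"
  assumes "\<F> \<subseteq> Pow {1..n}" "shifted \<F>" "three_wise_intersecting \<F>"
    and "\<And>i. i < 3 \<Longrightarrow> A i \<in> \<F>"
  shows "\<exists>j. 2 * j < (\<Sum>i<3. card (A i \<inter> {1..j}))"
  using assms(4)
proof (induction "card (\<Inter>i\<in>{..<3}. A i)" arbitrary: A rule: less_induct)
  case less
  define I where "I = (\<Inter>i\<in>{..<3}. A i)"
  define S where "S j = (\<Sum>i<3. card (A i \<inter> {1..j}))" for j
  define c where "c k = card {i \<in> {..<3}. k \<in> A i}" for k
  have A: "A i \<subseteq> {1..n}" if "i < 3" for i using less.prems[OF that] assms(1) by blast
  have S_Suc: "S (Suc j) = S j + c (Suc j)" for j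
  proof -
    have "card (A i \<inter> {1..Suc j}) = card (A i \<inter> {1..j}) + (if Suc j \<in> A i then 1 else 0)" for i
      by (simp add: atLeastAtMostSuc_conv)
    then have "S (Suc j) = S j + (\<Sum>i<3. if Suc j \<in> A i then 1 else 0)"
      by (simp add: S_def sum.distrib)
    also have "(\<Sum>i<3. if Suc j \<in> A i then 1 else 0) = c (Suc j)"
      by (simp add: c_def sum.If_cases Int_def)
    finally show ?thesis .
  qed
  show ?case
  proof (rule ccontr)
    assume "\<not> ?thesis"
    then have le: "S j \<le> 2 * j" for j by (auto simp: S_def not_less)
    have "I \<noteq> {}"
    proof -
      have "A 0 \<inter> A 1 \<inter> A 2 \<noteq> {}" using assms(3) less.prems by (auto simp: three_wise_intersecting_def)
      moreover have "{..<3} = {0, 1, 2::nat}" by auto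
      then have "I = A 0 \<inter> A 1 \<inter> A 2" unfolding I_def by (simp add: Int_assoc)
      ultimately show ?thesis by simp
    qed
    have IA: "I \<subseteq> A i" if "i < 3" for i using that by (auto simp: I_def)
    have finI: "finite I" using finite_subset[OF IA[of 0] finite_subset[OF A[of 0]]] by simp
    define x where "x = Min I"
    have x: "x \<in> I" "\<And>y. y \<in> I \<Longrightarrow> x \<le> y" using \<open>I \<noteq> {}\<close> finI by (auto simp: x_def)
    have "1 \<le> x" using x IA[of 0] A[of 0] by auto
    have cx: "c x = 3"
    proof -
      have "{i \<in> {..<3}. x \<in> A i} = {..<3}" using x IA by auto
      then show ?thesis by (simp add: c_def)
    qed
    have c2: "c k \<le> 2" if "k < x" for k
    proof -
      have "k \<notin> I" using x(2) that by force
      then have "{i \<in> {..<3}. k \<in> A i} \<subset> {..<3}" by (auto simp: I_def)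
      then have "c k < card {..<3::nat}" unfolding c_def by (intro psubset_card_mono) auto
      then show ?thesis by simp
    qed
    have "\<exists>y\<in>{1..<x}. c y \<le> 1"
    proof (rule ccontr)
      assume "\<not> ?thesis"
      then have c: "c k = 2" if "1 \<le> k" "k < x" for k using c2[OF that(2)] that by force
      have "S k = 2 * k" if "k < x" for k using that
      proof (induction k)
        case 0
        then show ?case by (simp add: S_def)
      next
        case (Suc k)
        then show ?case using S_Suc[of k] c[of "Suc k"] by simp
      qed
      then have "S x = 2 * (x - 1) + 3" using S_Suc[of "x - 1"] cx \<open>1 \<le> x\<close> by simp
      then show False using le[of x] \<open>1 \<le> x\<close> by linarith
    qed
    then have ne: "{y \<in> {1..<x}. c y \<le> 1} \<noteq> {}" by blast
    \<comment> \<open>The last such point is taken, so that all points strictly between y and x have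
      multiplicity exactly 2.\<close>
    define y where "y = Max {y \<in> {1..<x}. c y \<le> 1}"
    have "y \<in> {y \<in> {1..<x}. c y \<le> 1}" unfolding y_def using ne by (intro Max_in) auto
    then have y: "1 \<le> y" "y < x" "c y \<le> 1" by auto
    have yk: "c k = 2" if "y < k" "k < x" for k
    proof (rule ccontr)
      assume "c k \<noteq> 2"
      then have "k \<in> {y \<in> {1..<x}. c y \<le> 1}" using c2[OF that(2)] that y(1) by auto
      then have "k \<le> y" unfolding y_def by (intro Max_ge) auto
      then show False using that by simp
    qed
    \<comment> \<open>Going back over x loses 3 incidences against an allowance of 2, which creates
      the slack; multiplicity 2 keeps it constant down to y.\<close>
    have low: "S j + 1 \<le> 2 * j" if "y \<le> j" "j < x" for j
    proof -
      have "j \<le> x - 1" using that by simp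
      then show ?thesis
      proof (induction j rule: inc_induct)
        case base
        show ?case using S_Suc[of "x - 1"] cx le[of x] \<open>1 \<le> x\<close> y by simp
      next
        case (step m)
        then have "c (Suc m) = 2" using yk \<open>y \<le> j\<close> by simp
        then show ?case using step S_Suc[of m] by simp
      qed
    qed
    define M where "M = {i \<in> {..<3}. y \<notin> A i}"
    have "2 \<le> card M"
    proof -
      have "{..<3} = {i \<in> {..<3}. y \<in> A i} \<union> M" by (auto simp: M_def)
      then have "card {..<3::nat} = card ({i \<in> {..<3}. y \<in> A i} \<union> M)"
        by (rule arg_cong)
      also have "\<dots> = card {i \<in> {..<3}. y \<in> A i} + card M"
        by (intro card_Un_disjoint) (auto simp: M_def)
      finally show ?thesis using y(3) by (simp add: c_def)
    qed
    then obtain M' where "M' \<subseteq> M" "card M' = 2" by (meson obtain_subset_with_card_n)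
    then obtain i i' where i: "i \<in> M" "i' \<in> M" "i \<noteq> i'" by (auto simp: card_2_iff)
    then have i3: "i < 3" "i' < 3" "y \<notin> A i" "y \<notin> A i'" by (auto simp: M_def)
    define A' where "A' = A(i := insert y (A i - {x}))"
    have xA: "x \<in> A i" using x IA i3 by auto
    have F': "A' k \<in> \<F>" if "k < 3" for k
      using assms(2) less.prems that i3 xA y by (auto simp: A'_def shifted_def)
    have "(\<Inter>k\<in>{..<3}. A' k) \<subseteq> I - {x}"
    proof
      fix z assume z: "z \<in> (\<Inter>k\<in>{..<3}. A' k)"
      have "z \<in> A' i'" "z \<in> A' i" using z i3 by auto
      then have "z \<noteq> y" "z \<noteq> x" "z \<in> A i" using i3 i y(2) by (auto simp: A'_def)
      moreover have "z \<in> A k" if "k < 3" for k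
        using z that \<open>z \<in> A i\<close> by (cases "k = i") (auto simp: A'_def)
      ultimately show "z \<in> I - {x}" by (auto simp: I_def)
    qed
    then have "card (\<Inter>k\<in>{..<3}. A' k) < card I"
      using x(1) finI by (intro psubset_card_mono) auto
    then obtain j where j: "2 * j < (\<Sum>k<3. card (A' k \<inter> {1..j}))"
      using less.hyps[of A'] F' by (auto simp: I_def)
    have other: "(\<Sum>k\<in>{..<3} - {i}. card (A' k \<inter> {1..j})) = (\<Sum>k\<in>{..<3} - {i}. card (A k \<inter> {1..j}))"
      by (rule sum.cong) (auto simp: A'_def)
    have "card (A' i \<inter> {1..j}) \<le> card (A i \<inter> {1..j}) + (if y \<le> j \<and> j < x then 1 else 0)"
    proof -
      consider "j < y" | "y \<le> j" "j < x" | "x \<le> j" by linarith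
      then show ?thesis
      proof cases
        case 1
        then have "A' i \<inter> {1..j} \<subseteq> A i \<inter> {1..j}" by (auto simp: A'_def)
        then have "card (A' i \<inter> {1..j}) \<le> card (A i \<inter> {1..j})" by (intro card_mono) auto
        then show ?thesis by simp
      next
        case 2
        then have "A' i \<inter> {1..j} \<subseteq> insert y (A i \<inter> {1..j})" by (auto simp: A'_def)
        then have "card (A' i \<inter> {1..j}) \<le> card (insert y (A i \<inter> {1..j}))" by (intro card_mono) auto
        also have "\<dots> \<le> card (A i \<inter> {1..j}) + 1" by (simp add: card_insert_if)
        finally show ?thesis using 2 by simp
      next
        case 3
        have "A' i \<inter> {1..j} = insert y ((A i \<inter> {1..j}) - {x})" using 3 y by (auto simp: A'_def)
        also have "card \<dots> = Suc (card ((A i \<inter> {1..j}) - {x}))"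
          using i3 by (intro card_insert_disjoint) auto
        also have "\<dots> = card (A i \<inter> {1..j})"
          using 3 xA \<open>1 \<le> x\<close> by (intro card.remove[symmetric]) auto
        finally show ?thesis by simp
      qed
    qed
    then have "(\<Sum>k<3. card (A' k \<inter> {1..j})) \<le> S j + (if y \<le> j \<and> j < x then 1 else 0)"
      unfolding S_def using i3(1) other
      by (simp add: sum.remove[of "{..<3}" i] del: sum.lessThan_Suc)
    then show False using j le[of j] low[of j] by (auto split: if_splits)
  qed
qed

definition hits :: "nat \<Rightarrow> nat \<Rightarrow> nat \<Rightarrow> nat set \<Rightarrow> bool" where
  "hits a n u B \<longleftrightarrow> (\<exists>j\<in>{a..n}. int u \<le> 3 * int (card (B \<inter> {a+1..j})) - 2 * (int j - int a))"

text \<open>Reading \<open>B\<close> as a walk going up by one at each element of \<open>B\<close> and down by two otherwise,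
  \<open>hits a n u B\<close> says that the walk reaches height \<open>u\<close>; \<open>x\<close> is the probability that the
  infinite walk ever climbs one unit.\<close>

lemma pm_hits_le:
  fixes x :: real
  assumes p: "0 \<le> p" "p \<le> 1" and x: "0 \<le> x" "x = p + (1 - p) * x ^ 3" and "a \<le> n"
  shows "pm p {a+1..n} (hits a n u) \<le> x ^ u"
  using \<open>a \<le> n\<close>
proof (induction a arbitrary: u rule: inc_induct)
  case base
  show ?case
  proof (cases u)
    case 0
    then show ?thesis using p by (simp add: pm_le_1)
  next
    case (Suc v)
    then show ?thesis using x(1) by (simp add: hits_def)
  qed
next
  case (step a)
  show ?case
  proof (cases u)
    case 0
    then show ?thesis using p by (simp add: pm_le_1)
  next
    case (Suc v)
    have V: "{a+1..n} = insert (Suc a) {Suc a+1..n}" using step.hyps by auto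
    \<comment> \<open>As u > 0, the height is not reached before the first step. A step up leaves v
      = u - 1 to climb, a step down leaves u + 2 = v + 3.\<close>
    have sub: "hits (Suc a) n v B" if "hits a n u (insert (Suc a) B)" "B \<subseteq> {Suc a+1..n}" for B
    proof -
      from that obtain j where j: "a \<le> j" "j \<le> n"
        "int u \<le> 3 * int (card (insert (Suc a) B \<inter> {a+1..j})) - 2 * (int j - int a)"
        by (auto simp: hits_def)
      have "j \<noteq> a" using j Suc by auto
      then have "insert (Suc a) B \<inter> {a+1..j} = insert (Suc a) (B \<inter> {Suc a+1..j})"
        "Suc a \<notin> B \<inter> {Suc a+1..j}" using j that(2) by auto
      then have "card (insert (Suc a) B \<inter> {a+1..j}) = Suc (card (B \<inter> {Suc a+1..j}))" by simp
      then have "int v \<le> 3 * int (card (B \<inter> {Suc a+1..j})) - 2 * (int j - int (Suc a))"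
        using j(3) Suc by simp
      then show ?thesis unfolding hits_def using j \<open>j \<noteq> a\<close> by (intro bexI[of _ j]) auto
    qed
    have sub': "hits (Suc a) n (v + 3) B" if "hits a n u B" "B \<subseteq> {Suc a+1..n}" for B
    proof -
      from that obtain j where j: "a \<le> j" "j \<le> n"
        "int u \<le> 3 * int (card (B \<inter> {a+1..j})) - 2 * (int j - int a)"
        by (auto simp: hits_def)
      have "j \<noteq> a" using j Suc by auto
      have "B \<inter> {a+1..j} = B \<inter> {Suc a+1..j}" using that(2) by auto
      then have "int (v + 3) \<le> 3 * int (card (B \<inter> {Suc a+1..j})) - 2 * (int j - int (Suc a))"
        using j(3) Suc by simp
      then show ?thesis unfolding hits_def using j \<open>j \<noteq> a\<close> by (intro bexI[of _ j]) auto
    qed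
    have "pm p {a+1..n} (hits a n u) = p * pm p {Suc a+1..n} (\<lambda>B. hits a n u (insert (Suc a) B))
        + (1 - p) * pm p {Suc a+1..n} (hits a n u)"
      unfolding V by (rule pm_insert) auto
    also have "\<dots> \<le> p * pm p {Suc a+1..n} (hits (Suc a) n v)
        + (1 - p) * pm p {Suc a+1..n} (hits (Suc a) n (v + 3))"
      using p sub sub' by (intro add_mono mult_left_mono pm_mono) auto
    also have "\<dots> \<le> p * x ^ v + (1 - p) * x ^ (v + 3)"
      using p step.IH by (intro add_mono mult_left_mono) auto
    also have "\<dots> = x ^ v * (p + (1 - p) * x ^ 3)" by (simp add: algebra_simps power_add)
    also have "\<dots> = x ^ u" using x(2) Suc by simp
    finally show ?thesis .
  qed
qed

section \<open>The range \<open>2/5 \<le> p \<le> 1/2\<close>\<close>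

locale large_p =
  fixes n :: nat and p \<alpha> :: real and \<F> :: "nat set set"
  assumes n: "4 \<le> n" and p: "2/5 \<le> p" "p \<le> 1/2"
    and \<alpha>: "0 < \<alpha>" "\<alpha> + \<alpha>\<^sup>2 = p / (1 - p)"
    and F: "\<F> \<subseteq> Pow {1..n}" and up: "up_closed n \<F>" and sh: "shifted \<F>"
    and three: "three_wise_intersecting \<F>" and two: "t_intersecting 2 \<F>"
begin

definition x :: "nat set \<Rightarrow> real" where
  "x I = pm p {5..n} (\<lambda>B. I \<union> B \<in> \<F>)"

text \<open>A statement about every walk in the link, not about its measure: its negation supplies a
  single low walk, and three low walks can be combined against the prefix lemma.\<close>

definition lev :: "nat set \<Rightarrow> nat \<Rightarrow> bool" where
  "lev I u \<longleftrightarrow> (\<forall>B\<subseteq>{5..n}. I \<union> B \<in> \<F> \<longrightarrow> hits 4 n u B)"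

text \<open>For I inside {1..4}, up-closure makes this equivalent to the link of I being
  nonempty.\<close>

abbreviation occurs :: "nat set \<Rightarrow> bool" where
  "occurs I \<equiv> I \<union> {5..n} \<in> \<F>"

lemma p01: "0 \<le> p" "p \<le> 1" "0 < p" "p < 1" using p by auto

text \<open>The walk equation is a cubic with the root 1. Dividing by 1 - \<alpha> leaves the
  quadratic assumed in the locale.\<close>

lemma \<alpha>_walk: "\<alpha> = p + (1 - p) * \<alpha> ^ 3"
proof -
  have e: "(\<alpha> + \<alpha>\<^sup>2) * (1 - p) = p" unfolding \<alpha>(2) using p01 by simp
  have "\<alpha> - p - (1 - p) * \<alpha> ^ 3 = (1 - \<alpha>) * ((\<alpha> + \<alpha>\<^sup>2) * (1 - p) - p)"
    by (simp add: algebra_simps power2_eq_square power3_eq_cube)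
  then show ?thesis using e by simp
qed

lemma x_nonneg: "0 \<le> x I" and x_le_1: "x I \<le> 1"
  using p01 by (auto simp: x_def pm_nonneg pm_le_1)

lemma x_mono: "(\<And>B. B \<subseteq> {5..n} \<Longrightarrow> I \<union> B \<in> \<F> \<Longrightarrow> J \<union> B \<in> \<F>) \<Longrightarrow> x I \<le> x J"
  unfolding x_def using p01 by (intro pm_mono) auto

lemma up4: "I \<union> B \<in> \<F> \<Longrightarrow> I \<subseteq> J \<Longrightarrow> B \<subseteq> B' \<Longrightarrow> J \<subseteq> {1..4} \<Longrightarrow> B' \<subseteq> {5..n} \<Longrightarrow> J \<union> B' \<in> \<F>"
proof -
  assume a: "I \<union> B \<in> \<F>" "I \<subseteq> J" "B \<subseteq> B'" "J \<subseteq> {1..4}" "B' \<subseteq> {5..n}"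
  have "J \<union> B' \<subseteq> {1..n}" using a(4,5) n by fastforce
  moreover have "I \<union> B \<subseteq> J \<union> B'" using a by blast
  ultimately show ?thesis using up a(1) by (auto simp: up_closed_def)
qed

lemma x_eq_0: "I \<subseteq> {1..4} \<Longrightarrow> \<not> occurs I \<Longrightarrow> x I = 0"
  unfolding x_def using up4[of I _ I "{5..n}"] by (intro pm_eq_0) auto

lemma lev_x: "lev I u \<Longrightarrow> x I \<le> \<alpha> ^ u"
proof -
  assume "lev I u"
  then have "x I \<le> pm p {5..n} (hits 4 n u)"
    unfolding x_def using p01 by (intro pm_mono) (auto simp: lev_def)
  also have "\<dots> \<le> \<alpha> ^ u" using pm_hits_le[OF p01(1,2) _ \<alpha>_walk n] \<alpha>(1) by simp
  finally show ?thesis .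
qed

text \<open>The third set \<open>K \<union> {5..n}\<close> imposes nothing beyond {1..4}, and within
  {1..4} the three traces have no common point; so the links of I and J must meet in {5..n}.\<close>

lemma cross:
  assumes "I \<inter> J \<inter> K = {}" "occurs K" "I \<subseteq> {1..4}" "J \<subseteq> {1..4}"  "K \<subseteq> {1..4}"
  shows "x I + x J \<le> 1"
  unfolding x_def
proof (rule pm_cross_intersecting)
  fix A B assume AB: "A \<subseteq> {5..n}" "B \<subseteq> {5..n}" "I \<union> A \<in> \<F>" "J \<union> B \<in> \<F>"
  then have "(I \<union> A) \<inter> (J \<union> B) \<inter> (K \<union> {5..n}) \<noteq> {}"
    using three assms(2) unfolding three_wise_intersecting_def by blast
  then obtain z where z: "z \<in> I \<union> A" "z \<in> J \<union> B" "z \<in> K \<union> {5..n}" by blast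
  show "A \<inter> B \<noteq> {}"
  proof (cases "z \<le> 4")
    case True
    then have "z \<in> I \<inter> J \<inter> K" using z AB by fastforce
    then show ?thesis using assms(1) by blast
  next
    case False
    then have "z \<in> A \<inter> B" using z assms(3,4) by fastforce
    then show ?thesis by blast
  qed
qed (use p in auto)

text \<open>Otherwise each link contains a walk that never exceeds \<open>u i\<close>, and these
  three sets violate the prefix lemma. The conditions \<open>c\<close> exclude the prefixes j = 1,
  2, 3. For j \<ge> 4, three times the prefix count is at most the sum of the \<open>u i\<close>,
  plus 3 times the trace sizes, plus 6j - 24; reaching 3 (2j + 1) would need 27.\<close>

lemma triple:
  fixes I :: "nat \<Rightarrow> nat set" and u :: "nat \<Rightarrow> nat"
  assumes sub: "I 0 \<subseteq> {1..4}" "I 1 \<subseteq> {1..4}" "I 2 \<subseteq> {1..4}"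
    and c: "card (I 0 \<inter> {1}) + card (I 1 \<inter> {1}) + card (I 2 \<inter> {1}) \<le> 2"
      "card (I 0 \<inter> {1,2}) + card (I 1 \<inter> {1,2}) + card (I 2 \<inter> {1,2}) \<le> 4"
      "card (I 0 \<inter> {1,2,3}) + card (I 1 \<inter> {1,2,3}) + card (I 2 \<inter> {1,2,3}) \<le> 6"
    and t: "u 0 + u 1 + u 2 + 1 + 3 * (card (I 0) + card (I 1) + card (I 2)) \<le> (27::nat)"
  shows "lev (I 0) (u 0 + 1) \<or> lev (I 1) (u 1 + 1) \<or> lev (I 2) (u 2 + 1)"
proof (rule ccontr)
  assume neg: "\<not> ?thesis"
  have three_cases: "i = 0 \<or> i = 1 \<or> i = 2" if "i < 3" for i :: nat using that by auto
  have "\<forall>i\<in>{..<3}. \<exists>B\<subseteq>{5..n}. I i \<union> B \<in> \<F> \<and> \<not> hits 4 n (u i + 1) B"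
  proof
    fix i :: nat assume "i \<in> {..<3}"
    then have "\<not> lev (I i) (u i + 1)" using neg three_cases[of i] by auto
    then show "\<exists>B\<subseteq>{5..n}. I i \<union> B \<in> \<F> \<and> \<not> hits 4 n (u i + 1) B" by (auto simp: lev_def)
  qed
  then obtain B where B: "\<And>i. i < 3 \<Longrightarrow> B i \<subseteq> {5..n}" "\<And>i. i < 3 \<Longrightarrow> I i \<union> B i \<in> \<F>"
    "\<And>i. i < 3 \<Longrightarrow> \<not> hits 4 n (u i + 1) (B i)" by (metis lessThan_iff)
  have low: "3 * card (B i \<inter> {5..j}) \<le> u i + 2 * (j - 4)" if "i < 3" "4 \<le> j" "j \<le> n" for i j
    using B(3)[OF that(1)] that(2,3) unfolding hits_def by force
  have sum3: "(\<Sum>i<3. f i) = f 0 + f 1 + f 2" for f :: "nat \<Rightarrow> nat" by (simp add: numeral_3_eq_3 numeral_2_eq_2)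
  obtain j where j: "2 * j < (\<Sum>i<3. card ((I i \<union> B i) \<inter> {1..j}))"
    using shifted_three_wise_prefix[OF F sh three, of "\<lambda>i. I i \<union> B i"] B(2) by blast
  have I4: "I i \<subseteq> {1..4}" if "i < 3" for i using sub three_cases[OF that] by auto
  have finI: "finite (I i)" if "i < 3" for i using I4[OF that] finite_subset by blast
  have small: "(I i \<union> B i) \<inter> {1..j} = I i \<inter> {1..j}" if "i < 3" "j \<le> 4" for i j
    using B(1)[OF that(1)] that(2) by fastforce
  have large: "card ((I i \<union> B i) \<inter> {1..j}) = card (I i) + card (B i \<inter> {5..j})"
    if "i < 3" "4 \<le> j" for i j
  proof -
    have "(I i \<union> B i) \<inter> {1..j} = I i \<union> (B i \<inter> {5..j})"
      using B(1)[OF that(1)] I4[OF that(1)] that(2) by fastforce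
    moreover have "I i \<inter> (B i \<inter> {5..j}) = {}" using I4[OF that(1)] by fastforce
    ultimately show ?thesis using finI[OF that(1)] by (simp add: card_Un_disjoint)
  qed
  have final: "(\<Sum>i<3. card ((I i \<union> B i) \<inter> {1..j})) \<le> 2 * j" if "4 \<le> j" "j \<le> n" for j
    using low[of 0 j] low[of 1 j] low[of 2 j] large[of 0 j] large[of 1 j] large[of 2 j] that t
    unfolding sum3 by simp
  consider "j = 0" | "j = 1" | "j = 2" | "j = 3" | "4 \<le> j" "j \<le> n" | "n < j" by linarith
  then show False
  proof cases
    case 1
    then show ?thesis using j by simp
  next
    case 2
    have "{1..1} = {1::nat}" by auto
    then show ?thesis using 2 j c(1) small[of 0 1] small[of 1 1] small[of 2 1] unfolding sum3 by simp
  next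
    case 3
    have e: "{1..2} = {1, 2::nat}" by auto
    show ?thesis using j c(2) small[of 0 2] small[of 1 2] small[of 2 2] unfolding sum3 3 e by simp
  next
    case 4
    have e: "{1..3} = {1, 2, 3::nat}" by auto
    show ?thesis using j c(3) small[of 0 3] small[of 1 3] small[of 2 3] unfolding sum3 4 e by simp
  next
    case 5
    then show ?thesis using final j by force
  next
    case 6
    have "(I i \<union> B i) \<inter> {1..j} = (I i \<union> B i) \<inter> {1..n}" if "i < 3" for i
      using B(2)[OF that] F 6 by fastforce
    then have "(\<Sum>i<3. card ((I i \<union> B i) \<inter> {1..j})) = (\<Sum>i<3. card ((I i \<union> B i) \<inter> {1..n}))"
      by (intro sum.cong) auto
    then show ?thesis using final[of n] n j 6 by simp
  qed
qed

lemma triple':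
  assumes "I \<subseteq> {1..4}" "J \<subseteq> {1..4}" "K \<subseteq> {1..4}"
    and "card (I \<inter> {1}) + card (J \<inter> {1}) + card (K \<inter> {1}) \<le> 2"
      "card (I \<inter> {1,2}) + card (J \<inter> {1,2}) + card (K \<inter> {1,2}) \<le> 4"
      "card (I \<inter> {1,2,3}) + card (J \<inter> {1,2,3}) + card (K \<inter> {1,2,3}) \<le> 6"
    and "u + v + w + 1 + 3 * (card I + card J + card K) \<le> 27"
  shows "lev I (u + 1) \<or> lev J (v + 1) \<or> lev K (w + 1)"
  using triple[of "\<lambda>i. if i = 0 then I else if i = 1 then J else K"
      "\<lambda>i. if i = 0 then u else if i = 1 then v else w"] assms by simp

text \<open>The same trace is used three times, which the condition on the first prefix permits as 1
  is missing. The budget 27 then yields the exponent 9 - 3 card I.\<close>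

lemma x_self:
  "x {2, 3} \<le> \<alpha> ^ 3" "x {2, 4} \<le> \<alpha> ^ 3" "x {3, 4} \<le> \<alpha> ^ 3"
  "x {2} \<le> \<alpha> ^ 6" "x {3} \<le> \<alpha> ^ 6" "x {4} \<le> \<alpha> ^ 6" "x {} \<le> \<alpha> ^ 9"
proof -
  have "lev {2, 3} 3" using triple'[of "{2, 3}" "{2, 3}" "{2, 3}" 2 2 2] by simp
  then show "x {2, 3} \<le> \<alpha> ^ 3" by (rule lev_x)
  have "lev {2, 4} 3" using triple'[of "{2, 4}" "{2, 4}" "{2, 4}" 2 2 2] by simp
  then show "x {2, 4} \<le> \<alpha> ^ 3" by (rule lev_x)
  have "lev {3, 4} 3" using triple'[of "{3, 4}" "{3, 4}" "{3, 4}" 2 2 2] by simp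
  then show "x {3, 4} \<le> \<alpha> ^ 3" by (rule lev_x)
  have "lev {2} 6" using triple'[of "{2}" "{2}" "{2}" 5 5 5] by simp
  then show "x {2} \<le> \<alpha> ^ 6" by (rule lev_x)
  have "lev {3} 6" using triple'[of "{3}" "{3}" "{3}" 5 5 5] by simp
  then show "x {3} \<le> \<alpha> ^ 6" by (rule lev_x)
  have "lev {4} 6" using triple'[of "{4}" "{4}" "{4}" 5 5 5] by simp
  then show "x {4} \<le> \<alpha> ^ 6" by (rule lev_x)
  have "lev {} 9" using triple'[of "{}" "{}" "{}" 8 8 8] by simp
  then show "x {} \<le> \<alpha> ^ 9" by (rule lev_x)
qed

text \<open>The traces {1, 2} and {1, 3} are combined with {2, 3} and with {2, 3, 4}, and a budget u
  + v \<le> 4 remains for the first two. If the third trace does not absorb it, the splits 0 + 4, 1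
  + 3 and 2 + 2 all apply. Height 3 for {1, 2} passes to {1, 3}, whose link is smaller.\<close>

lemma levels:
  "x {2, 3, 4} \<le> \<alpha> ^ 2 \<and> x {2, 3} \<le> \<alpha> ^ 5 \<or> x {1, 2} \<le> \<alpha> ^ 2 \<and> x {1, 3} \<le> \<alpha> ^ 3 \<or>
   x {1, 2} \<le> \<alpha> \<and> x {1, 3} \<le> \<alpha> ^ 4 \<or> x {1, 3} \<le> \<alpha> ^ 5"
proof -
  have k: "lev {1, 2} (u + 1) \<or> lev {1, 3} (v + 1) \<or> lev {2, 3} 5" if "u + v \<le> 4" for u v
    using triple'[of "{1, 2}" "{1, 3}" "{2, 3}" u v 4] that by simp
  have h: "lev {1, 2} (u + 1) \<or> lev {1, 3} (v + 1) \<or> lev {2, 3, 4} 2" if "u + v \<le> 4" for u v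
    using triple'[of "{1, 2}" "{1, 3}" "{2, 3, 4}" u v 1] that by (simp add: numeral_2_eq_2)
  have m: "lev {1, 3} w" if "lev {1, 2} w" for w
    using that shifted_pairs(6)[OF sh] by (auto simp: lev_def)
  have A: "lev {2, 3, 4} 2 \<and> lev {2, 3} 5 \<or> lev {1, 2} (u + 1) \<or> lev {1, 3} (v + 1)"
    if "u + v \<le> 4" for u v using k[OF that] h[OF that] by blast
  have "lev {2, 3, 4} 2 \<and> lev {2, 3} 5 \<or> lev {1, 2} 2 \<and> lev {1, 3} 3 \<or>
      lev {1, 2} 1 \<and> lev {1, 3} 4 \<or> lev {1, 3} 5"
    using A[of 0 4] A[of 1 3] A[of 2 2] m[of 3] by (auto simp: numeral_eq_Suc)
  then show ?thesis using lev_x[of _ 1] lev_x by auto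
qed

end

section \<open>Numerical estimates in \<open>a\<close>, where
  \<open>a + a^2 = p / (1 - p)\<close>\<close>

lemma ratio_mono:
  fixes a u :: real
  assumes "0 \<le> a" "a \<le> u"
  shows "a / (1 + a) \<le> u / (1 + u)"
  using assms by (simp add: field_simps)

text \<open>Since \<open>p / (1 - p) = a + a\<^sup>2\<close>, the final estimates only involve \<open>a\<close>, and \<open>2/5 \<le> p \<le> 1/2\<close>
  confines \<open>a\<close> to the interval used below. On each of a few subintervals \<open>[l, u]\<close> it suffices to
  compare the increasing left-hand side at \<open>u\<close> with the increasing right-hand side at \<open>l\<close>.\<close>

lemma levels_aux:
  fixes a t l u T :: real
  assumes "0 \<le> l" "l \<le> a" "a \<le> u" "0 \<le> t" "t \<le> T"
    and num: "(u + u\<^sup>2) * u\<^sup>2 + 3 * u ^ 5 + 3 * u ^ 4 * T + u ^ 5 * T\<^sup>2 + 1 < 2 * (l + l\<^sup>2)"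
  shows "(a + a\<^sup>2) * a\<^sup>2 + 3 * a ^ 5 + 3 * a ^ 4 * t + a ^ 5 * t\<^sup>2 + 1 < 2 * (a + a\<^sup>2)"
proof -
  have "(a + a\<^sup>2) * a\<^sup>2 + 3 * a ^ 5 + 3 * a ^ 4 * t + a ^ 5 * t\<^sup>2 + 1
      \<le> (u + u\<^sup>2) * u\<^sup>2 + 3 * u ^ 5 + 3 * u ^ 4 * T + u ^ 5 * T\<^sup>2 + 1"
    using assms(1-5) by (intro add_mono mult_mono power_mono order_refl) auto
  moreover have "2 * (l + l\<^sup>2) \<le> 2 * (a + a\<^sup>2)"
    using assms(1-5) by (intro mult_left_mono add_mono power_mono) auto
  ultimately show ?thesis using num by linarith
qed

text \<open>The endpoints round outwards the positive roots of a + a^2 = 2/3 and a + a^2 = 1, which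
  belong to p = 2/5 and p = 1/2.\<close>

lemma levels_numeric:
  fixes a t :: real
  assumes a: "457/1000 \<le> a" "a \<le> 6181/10000" and t: "t = a / (1 + a)"
  shows "(a + a\<^sup>2) * a\<^sup>2 + 3 * a ^ 5 + 3 * a ^ 4 * t + a ^ 5 * t\<^sup>2 + 1 < 2 * (a + a\<^sup>2)"
proof -
  have t0: "0 \<le> t" using a t by simp
  have T: "t \<le> u / (1 + u)" if "a \<le> u" for u using ratio_mono[OF _ that] a t by simp
  consider "a \<le> 492/1000" | "492/1000 \<le> a" "a \<le> 537/1000" | "537/1000 \<le> a" "a \<le> 582/1000"
    | "582/1000 \<le> a" by linarith
  then show ?thesis
  proof cases
    case 1
    show ?thesis by (rule levels_aux[OF _ a(1) 1 t0 T[OF 1]]) (simp_all add: power_divide)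
  next
    case 2
    show ?thesis by (rule levels_aux[OF _ 2 t0 T[OF 2(2)]]) (simp_all add: power_divide)
  next
    case 3
    show ?thesis by (rule levels_aux[OF _ 3 t0 T[OF 3(2)]]) (simp_all add: power_divide)
  next
    case 4
    show ?thesis by (rule levels_aux[OF _ 4 a(2) t0 T[OF a(2)]]) (simp_all add: power_divide)
  qed
qed

lemma case34_high_numeric:
  fixes a t :: real
  assumes a: "457/1000 \<le> a" "a \<le> 6181/10000" and t: "t = a / (1 + a)"
  shows "3 * a ^ 3 + a\<^sup>2 + 2 * a ^ 3 + a * t + 3 * a ^ 4 * t + a ^ 5 * t\<^sup>2 < 2 * (a + a\<^sup>2)"
proof -
  define U :: real where "U = 6181/10000"
  define T :: real where "T = 6181/16181"
  have t': "0 \<le> t" "t \<le> T" using ratio_mono[OF _ a(2)] a t by (simp_all add: T_def)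
  \<comment> \<open>The terms in a^2 are collected on the left and a factor a is cancelled. What
    remains is increasing against a constant, so the right endpoint decides without
    subdivision.\<close>
  have "a * (5 * a - 1) + t + 3 * (a ^ 3 * t) + a ^ 4 * t\<^sup>2
      \<le> U * (5 * U - 1) + T + 3 * (U ^ 3 * T) + U ^ 4 * T\<^sup>2"
    using a t' by (intro add_mono mult_mono power_mono order_refl) (auto simp: U_def T_def)
  also have "\<dots> < 2" by (simp add: U_def T_def power_divide)
  finally have "a * (a * (5 * a - 1) + t + 3 * (a ^ 3 * t) + a ^ 4 * t\<^sup>2) < a * 2"
    using a by (intro mult_strict_left_mono) auto
  then show ?thesis by (simp add: algebra_simps power2_eq_square power3_eq_cube power4_eq_xxxx eval_nat_numeral)
qed

lemma case34_low_aux: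
  fixes a t l u T :: real
  assumes "0 \<le> l" "l \<le> a" "a \<le> u" "0 \<le> t" "t \<le> T"
    and num: "3 * u ^ 3 + 1/2 + 2 * u ^ 4 + u\<^sup>2 * T + 3 * u ^ 4 * T + u ^ 5 * T\<^sup>2 < 2 * (l + l\<^sup>2)"
  shows "3 * a ^ 3 + 1/2 + 2 * a ^ 4 + a\<^sup>2 * t + 3 * a ^ 4 * t + a ^ 5 * t\<^sup>2 < 2 * (a + a\<^sup>2)"
proof -
  have "3 * a ^ 3 + 1/2 + 2 * a ^ 4 + a\<^sup>2 * t + 3 * a ^ 4 * t + a ^ 5 * t\<^sup>2
      \<le> 3 * u ^ 3 + 1/2 + 2 * u ^ 4 + u\<^sup>2 * T + 3 * u ^ 4 * T + u ^ 5 * T\<^sup>2"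
    using assms(1-5) by (intro add_mono mult_mono power_mono order_refl) auto
  moreover have "2 * (l + l\<^sup>2) \<le> 2 * (a + a\<^sup>2)"
    using assms(1-5) by (intro mult_left_mono add_mono power_mono) auto
  ultimately show ?thesis using num by linarith
qed

text \<open>The summand 1/2 stands for \<open>x {1, 2}\<close>, whose link is cross-intersecting
  with itself when {3, 4} occurs.\<close>

lemma case34_low_numeric:
  fixes a t :: real
  assumes a: "457/1000 \<le> a" "a \<le> 6181/10000" and t: "t = a / (1 + a)"
  shows "3 * a ^ 3 + 1/2 + 2 * a ^ 4 + a\<^sup>2 * t + 3 * a ^ 4 * t + a ^ 5 * t\<^sup>2 < 2 * (a + a\<^sup>2)"
proof -
  have t0: "0 \<le> t" using a t by simp
  have T: "t \<le> u / (1 + u)" if "a \<le> u" for u using ratio_mono[OF _ that] a t by simp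
  consider "a \<le> 53/100" | "53/100 \<le> a" "a \<le> 58/100" | "58/100 \<le> a" by linarith
  then show ?thesis
  proof cases
    case 1
    show ?thesis by (rule case34_low_aux[OF _ a(1) 1 t0 T[OF 1]]) (simp_all add: power_divide)
  next
    case 2
    show ?thesis by (rule case34_low_aux[OF _ 2 t0 T[OF 2(2)]]) (simp_all add: power_divide)
  next
    case 3
    show ?thesis by (rule case34_low_aux[OF _ 3 a(2) t0 T[OF a(2)]]) (simp_all add: power_divide)
  qed
qed

text \<open>The summand (a + a^2) / 2 is r / 2 and serves twice: it bounds
  \<open>r * x {2, 3, 4}\<close> when {2, 3} is the decisive pair, and it dominates a^3 + a^4 t when
  {2, 4} is.\<close>

lemma case23_high_numeric:
  fixes a t :: real
  assumes a: "457/1000 \<le> a" "a \<le> 6181/10000" and t: "t = a / (1 + a)"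
  shows "(a + a\<^sup>2) / 2 + a ^ 3 + a\<^sup>2 + 2 * a ^ 3 + a * t < 2 * (a + a\<^sup>2)"
proof -
  have "t \<le> 6181/16181" using ratio_mono[OF _ a(2)] a t by simp
  moreover have "a * a \<le> (6181/10000) * (6181/10000)" using a by (intro mult_mono) auto
  ultimately have "3 * (a * a) + t < 3/2 + a / 2" using a by simp
  then have "a * (3 * (a * a) + t) < a * (3/2 + a / 2)" using a by (intro mult_strict_left_mono) auto
  then show ?thesis
    by (simp add: algebra_simps add_divide_distrib power2_eq_square power3_eq_cube)
qed

lemma case23_mid_numeric:
  fixes a t :: real
  assumes a: "457/1000 \<le> a" "a \<le> 6181/10000" and t: "t = a / (1 + a)"
  shows "(a + a\<^sup>2) / 2 + a ^ 3 + a + 2 * a ^ 4 + a\<^sup>2 * t < 2 * (a + a\<^sup>2)"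
proof -
  have t': "0 \<le> t" "t \<le> 6181/16181" using ratio_mono[OF _ a(2)] a t by simp_all
  have "a\<^sup>2 + 2 * a ^ 3 + a * t
      \<le> (6181/10000)\<^sup>2 + 2 * (6181/10000) ^ 3 + (6181/10000) * (6181/16181)"
    using a t' by (intro add_mono mult_mono power_mono order_refl) auto
  also have "\<dots> < 1/2 + 3/2 * (457/1000)" by (simp add: power_divide)
  also have "\<dots> \<le> 1/2 + 3/2 * a" using a by simp
  finally have "a * (a\<^sup>2 + 2 * a ^ 3 + a * t) < a * (1/2 + 3/2 * a)"
    using a by (intro mult_strict_left_mono) auto
  then show ?thesis
    by (simp add: algebra_simps add_divide_distrib power2_eq_square power3_eq_cube power4_eq_xxxx)
qed

lemma case23_low_aux:
  fixes a l u :: real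
  assumes "0 \<le> l" "l \<le> a" "a \<le> u"
    and num: "1 + 2 * u ^ 3 + u ^ 4 + 2 * u ^ 5 < 2 * (l + l\<^sup>2)"
  shows "1 + 2 * a ^ 3 + a ^ 4 + 2 * a ^ 5 < 2 * (a + a\<^sup>2)"
proof -
  have "1 + 2 * a ^ 3 + a ^ 4 + 2 * a ^ 5 \<le> 1 + 2 * u ^ 3 + u ^ 4 + 2 * u ^ 5"
    using assms(1-3) by (intro add_mono mult_mono power_mono order_refl) auto
  moreover have "2 * (l + l\<^sup>2) \<le> 2 * (a + a\<^sup>2)"
    using assms(1-3) by (intro mult_left_mono add_mono power_mono) auto
  ultimately show ?thesis using num by linarith
qed

lemma case23_low_numeric:
  fixes a t :: real
  assumes a: "457/1000 \<le> a" "a \<le> 6181/10000" and t: "t = a / (1 + a)"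
  shows "1 + 2 * a ^ 3 + a ^ 4 * t + 2 * a ^ 5 + a ^ 3 * t < 2 * (a + a\<^sup>2)"
proof -
  \<comment> \<open>The two summands with t add up to a^4, so a polynomial inequality
    remains.\<close>
  have "t * (1 + a) = a" using a t by simp
  then have "a ^ 3 * (t * (1 + a)) = a ^ 4" by (simp add: eval_nat_numeral)
  then have e: "a ^ 4 * t + a ^ 3 * t = a ^ 4" by (simp add: algebra_simps eval_nat_numeral)
  consider "a \<le> 48/100" | "48/100 \<le> a" "a \<le> 515/1000" | "515/1000 \<le> a" "a \<le> 56/100"
    | "56/100 \<le> a" "a \<le> 605/1000" | "605/1000 \<le> a" by linarith
  then have "1 + 2 * a ^ 3 + a ^ 4 + 2 * a ^ 5 < 2 * (a + a\<^sup>2)"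
  proof cases
    case 1
    show ?thesis by (rule case23_low_aux[OF _ a(1) 1]) (simp_all add: power_divide)
  next
    case 2
    show ?thesis by (rule case23_low_aux[OF _ 2]) (simp_all add: power_divide)
  next
    case 3
    show ?thesis by (rule case23_low_aux[OF _ 3]) (simp_all add: power_divide)
  next
    case 4
    show ?thesis by (rule case23_low_aux[OF _ 4]) (simp_all add: power_divide)
  next
    case 5
    show ?thesis by (rule case23_low_aux[OF _ 5 a(2)]) (simp_all add: power_divide)
  qed
  then show ?thesis using e by linarith
qed

text \<open>The extracted factor is p^2 q^2. Only powers of r and of its inverse \<rho> remain, and
  these are expressible through \<alpha>.\<close>

lemma normalise:
  fixes p q r \<rho> :: real
  assumes "p = r * q" "\<rho> * r = 1"
  shows "p ^ 3 * q * A + p\<^sup>2 * q\<^sup>2 * B + p * q ^ 3 * C + q ^ 4 * D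
    = q ^ 4 * r\<^sup>2 * (r * A + B + \<rho> * C + \<rho>\<^sup>2 * D)"
proof -
  have "q ^ 4 * r\<^sup>2 * (r * A + B + \<rho> * C + \<rho>\<^sup>2 * D)
      = q ^ 4 * (r ^ 3 * A + r\<^sup>2 * B + r * (\<rho> * r) * C + (\<rho> * r)\<^sup>2 * D)"
    by (simp add: algebra_simps eval_nat_numeral)
  then show ?thesis unfolding assms(2) assms(1) by (simp add: algebra_simps eval_nat_numeral)
qed

lemma normalise_link:
  fixes p q r \<rho> :: real
  assumes "p = r * q" "\<rho> * r = 1"
  shows "q * (p ^ 3 * A + p\<^sup>2 * q * B + p * q\<^sup>2 * C + q ^ 3 * D)
    = q ^ 4 * r\<^sup>2 * (r * A + B + \<rho> * C + \<rho>\<^sup>2 * D)"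
  unfolding normalise[OF assms, symmetric] by (simp add: algebra_simps eval_nat_numeral)

text \<open>Identifies the gap between p^2 and the measure of \<open>BD3\<close> as p^2 q^2 (2r -
  1), the room left for the sets that avoid 1.\<close>

lemma normalise_bound:
  fixes p q r :: real
  assumes "p = r * q" "p + q = 1"
  shows "p\<^sup>2 + q ^ 4 * r\<^sup>2 * (2 * r - 1) = 4 * p ^ 3 * q + p ^ 4"
proof -
  have "p\<^sup>2 = p\<^sup>2 * (p + q)\<^sup>2" using assms(2) by simp
  then show ?thesis unfolding assms(1) by (simp add: algebra_simps eval_nat_numeral)
qed

section \<open>Comparing the sixteen links with \<open>BD3\<close>\<close>

context large_p
begin

definition r :: real where "r = p / (1 - p)"
definition \<rho> :: real where "\<rho> = (1 - p) / p"
text \<open>This is \<rho> \<alpha>^2, so a factor \<rho> turns \<alpha>^(k + 2) into \<alpha>^k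
  t.\<close>

definition t :: real where "t = \<alpha> / (1 + \<alpha>)"

lemma p_eq: "p = r * (1 - p)" using p01 by (simp add: r_def)

lemma r_eq: "r = \<alpha> + \<alpha>\<^sup>2" using \<alpha>(2) by (simp add: r_def)

lemma r_bounds: "2/3 \<le> r" "r \<le> 1" using p by (simp_all add: r_def field_simps)

lemma \<rho>_r: "\<rho> * r = 1" "0 \<le> \<rho>" using p01 by (simp_all add: \<rho>_def r_def)

lemma \<alpha>_bounds: "457/1000 \<le> \<alpha>" "\<alpha> \<le> 6181/10000"
proof -
  show "457/1000 \<le> \<alpha>"
  proof (rule ccontr)
    assume *: "\<not> ?thesis"
    then have "\<alpha> * \<alpha> \<le> (457/1000) * (457/1000)" using * \<alpha>(1) by (intro mult_mono) auto
    then show False using r_bounds(1) * unfolding r_eq power2_eq_square by simp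
  qed
  show "\<alpha> \<le> 6181/10000"
  proof (rule ccontr)
    assume *: "\<not> ?thesis"
    then have "(6181/10000) * (6181/10000) \<le> \<alpha> * \<alpha>" using * by (intro mult_mono) auto
    then show False using r_bounds(2) * unfolding r_eq power2_eq_square by simp
  qed
qed

lemma t_nonneg: "0 \<le> t" using \<alpha>(1) by (simp add: t_def)

lemma \<rho>_powers:
  "\<rho> * \<alpha> ^ 3 = \<alpha> * t" "\<rho> * \<alpha> ^ 4 = \<alpha>\<^sup>2 * t" "\<rho> * \<alpha> ^ 5 = \<alpha> ^ 3 * t" "\<rho> * \<alpha> ^ 6 = \<alpha> ^ 4 * t"
  "\<rho>\<^sup>2 * \<alpha> ^ 9 = \<alpha> ^ 5 * t\<^sup>2"
proof -
  have "\<rho> * (\<alpha> * (1 + \<alpha>)) = 1" using \<rho>_r(1) by (simp add: r_eq algebra_simps power2_eq_square)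
  moreover have "t * (1 + \<alpha>) = \<alpha>" using \<alpha>(1) by (simp add: t_def)
  moreover have "\<rho> * \<alpha> * (t * (1 + \<alpha>)) = t * (\<rho> * (\<alpha> * (1 + \<alpha>)))" by (simp only: ac_simps)
  ultimately have e: "\<rho> * \<alpha>\<^sup>2 = t" by (simp add: power2_eq_square mult.assoc)
  show "\<rho> * \<alpha> ^ 3 = \<alpha> * t" "\<rho> * \<alpha> ^ 4 = \<alpha>\<^sup>2 * t" "\<rho> * \<alpha> ^ 5 = \<alpha> ^ 3 * t" "\<rho> * \<alpha> ^ 6 = \<alpha> ^ 4 * t"
    "\<rho>\<^sup>2 * \<alpha> ^ 9 = \<alpha> ^ 5 * t\<^sup>2"
    unfolding e[symmetric] by (simp_all add: eval_nat_numeral algebra_simps)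
qed

lemma pm_link:
  "pm p {1..n} (\<lambda>A. A \<in> \<F>) = p * pm p {2..n} (\<lambda>A. insert 1 A \<in> \<F>)
     + (1 - p) * pm p {2..n} (\<lambda>A. A \<in> \<F>)"
proof -
  have V: "{1..n} = insert 1 {2..n}" using n by auto
  show ?thesis unfolding V by (rule pm_insert) auto
qed

lemma pm_expand3:
  "pm p {2..n} Q = p ^ 3 * pm p {5..n} (\<lambda>B. Q ({2, 3, 4} \<union> B))
    + p\<^sup>2 * (1 - p) * (pm p {5..n} (\<lambda>B. Q ({2, 3} \<union> B)) + pm p {5..n} (\<lambda>B. Q ({2, 4} \<union> B))
        + pm p {5..n} (\<lambda>B. Q ({3, 4} \<union> B)))
    + p * (1 - p)\<^sup>2 * (pm p {5..n} (\<lambda>B. Q ({2} \<union> B)) + pm p {5..n} (\<lambda>B. Q ({3} \<union> B))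
        + pm p {5..n} (\<lambda>B. Q ({4} \<union> B)))
    + (1 - p) ^ 3 * pm p {5..n} Q"
proof -
  have V: "{2..n} = insert 2 (insert 3 (insert 4 {5..n}))" using n by auto
  show ?thesis
    unfolding V by (simp add: pm_insert algebra_simps power2_eq_square power3_eq_cube)
qed

lemma p_measure_expand:
  "p_measure n p \<F> = p ^ 4 * x {1, 2, 3, 4}
    + p ^ 3 * (1 - p) * (x {1, 2, 3} + x {1, 2, 4} + x {1, 3, 4} + x {2, 3, 4})
    + p\<^sup>2 * (1 - p)\<^sup>2 * (x {1, 2} + x {1, 3} + x {1, 4} + x {2, 3} + x {2, 4} + x {3, 4})
    + p * (1 - p) ^ 3 * (x {1} + x {2} + x {3} + x {4}) + (1 - p) ^ 4 * x {}"
  unfolding p_measure_eq_pm[OF F] pm_link pm_expand3 x_def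
  by (simp add: algebra_simps eval_nat_numeral)

text \<open>Two members containing 1 share a further point, so the link of 1 is intersecting and has
  measure at most p; with the weight p of the element 1 this contributes at most p^2.\<close>

lemma p_measure_le_link:
  "p_measure n p \<F> \<le> p\<^sup>2 + (1 - p) * (p ^ 3 * x {2, 3, 4}
    + p\<^sup>2 * (1 - p) * (x {2, 3} + x {2, 4} + x {3, 4})
    + p * (1 - p)\<^sup>2 * (x {2} + x {3} + x {4}) + (1 - p) ^ 3 * x {})"
proof -
  \<comment> \<open>The link is kept on the full ground set, with 1 irrelevant for membership, so
    that the bound for intersecting families on {1..n} applies directly.\<close>
  let ?G = "{A \<in> Pow {1..n}. insert 1 A \<in> \<F>}"
  have "A \<inter> B \<noteq> {}" if "A \<in> ?G" "B \<in> ?G" for A B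
  proof
    assume "A \<inter> B = {}"
    then have "insert 1 A \<inter> insert 1 B \<subseteq> {1}" by auto
    then have "card (insert 1 A \<inter> insert 1 B) \<le> card {1::nat}" by (intro card_mono) auto
    moreover have "2 \<le> card (insert 1 A \<inter> insert 1 B)"
      using two that unfolding t_intersecting_def by blast
    ultimately show False by simp
  qed
  moreover have "finite A" if "A \<in> ?G" for A using that finite_subset by auto
  ultimately have "?G \<in> t_families n 1"
    by (auto simp: t_families_def t_intersecting_def Suc_le_eq card_gt_0_iff)
  then have "p_measure n p ?G \<le> p" using p by (intro intersecting_p_measure_le) auto
  moreover have "p_measure n p ?G = pm p {2..n} (\<lambda>A. insert 1 A \<in> \<F>)"
  proof -
    have V: "{1..n} = insert 1 {2..n}" using n by auto
    have "p_measure n p ?G = pm p {1..n} (\<lambda>A. A \<in> ?G)" by (rule p_measure_eq_pm) auto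
    also have "\<dots> = pm p {1..n} (\<lambda>A. insert 1 A \<in> \<F>)" by (rule pm_cong) simp
    also have "\<dots> = pm p {2..n} (\<lambda>A. insert 1 A \<in> \<F>)"
      unfolding V by (subst pm_insert) (auto simp: algebra_simps)
    finally show ?thesis .
  qed
  ultimately have "p * pm p {2..n} (\<lambda>A. insert 1 A \<in> \<F>) \<le> p * p"
    using p01 by (intro mult_left_mono) auto
  then show ?thesis
    unfolding p_measure_eq_pm[OF F] pm_link pm_expand3[of "\<lambda>A. A \<in> \<F>"] x_def
    by (simp add: power2_eq_square)
qed

text \<open>Normalised by \<open>p\<^sup>2 (1 - p)\<^sup>2\<close>, the bound \<open>4 p\<^sup>3 (1 - p) + p\<^sup>4\<close> reads \<open>4 r + r\<^sup>2\<close>.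
  The first criterion bounds the sets containing 1 by an intersecting family, the second one
  only uses \<open>x {1, 2, 3, 4} \<le> 1\<close>.\<close>

lemma criterion_link:
  assumes "r * x {2, 3, 4} + (x {2, 3} + x {2, 4} + x {3, 4}) + \<rho> * (x {2} + x {3} + x {4})
      + \<rho>\<^sup>2 * x {} < 2 * r - 1" (is "?Z < _")
  shows "p_measure n p \<F> < 4 * p ^ 3 * (1 - p) + p ^ 4"
proof -
  have "p_measure n p \<F> \<le> p\<^sup>2 + (1 - p) ^ 4 * r\<^sup>2 * ?Z"
    using p_measure_le_link unfolding normalise_link[OF p_eq \<rho>_r(1)] .
  also have "\<dots> < p\<^sup>2 + (1 - p) ^ 4 * r\<^sup>2 * (2 * r - 1)"
    using assms p01 r_bounds by (intro add_strict_left_mono mult_strict_left_mono) auto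
  also have "\<dots> = 4 * p ^ 3 * (1 - p) + p ^ 4" by (rule normalise_bound[OF p_eq]) simp
  finally show ?thesis .
qed

lemma criterion_total:
  assumes "r * (x {1, 2, 3} + x {1, 2, 4} + x {1, 3, 4} + x {2, 3, 4})
      + (x {1, 2} + x {1, 3} + x {1, 4} + x {2, 3} + x {2, 4} + x {3, 4})
      + \<rho> * (x {1} + x {2} + x {3} + x {4}) + \<rho>\<^sup>2 * x {} < 4 * r" (is "?Z < _")
  shows "p_measure n p \<F> < 4 * p ^ 3 * (1 - p) + p ^ 4"
proof -
  have "p_measure n p \<F> = p ^ 4 * x {1, 2, 3, 4} + (1 - p) ^ 4 * r\<^sup>2 * ?Z"
    unfolding normalise[OF p_eq \<rho>_r(1), symmetric] p_measure_expand by simp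
  also have "\<dots> < p ^ 4 * 1 + (1 - p) ^ 4 * r\<^sup>2 * (4 * r)"
    using assms p01 r_bounds x_le_1
    by (intro add_le_less_mono mult_strict_left_mono mult_left_mono) auto
  also have "\<dots> = 4 * p ^ 3 * (1 - p) + p ^ 4"
    using normalise[OF p_eq \<rho>_r(1), of 4 0 0 0] by (simp add: algebra_simps)
  finally show ?thesis .
qed

text \<open>If the first alternative of \<open>levels\<close> holds, the sets avoiding 1 are small
  enough for the link criterion. Otherwise the cases are ordered by the first pair among {3, 4}, {2,
  4}, {2, 3} that occurs: an occurring pair serves as third set in \<open>cross\<close> and bounds
  the links of triples, while the pairs already excluded make their own links and those of their
  subsets vanish.\<close>

lemma p_measure_less:
  assumes occ12: "occurs {1, 2}"
  shows "p_measure n p \<F> < 4 * p ^ 3 * (1 - p) + p ^ 4"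
proof -
  let ?K = "x {2, 3} + x {2, 4} + x {3, 4}"
  let ?S = "x {1, 2, 3} + x {1, 2, 4} + x {1, 3, 4} + x {2, 3, 4}"
  have pairs: "{3, 4} \<union> B \<in> \<F> \<Longrightarrow> {2, 4} \<union> B \<in> \<F>" "{2, 4} \<union> B \<in> \<F> \<Longrightarrow> {2, 3} \<union> B \<in> \<F>"
    "{2, 3} \<union> B \<in> \<F> \<Longrightarrow> {1, 3} \<union> B \<in> \<F>" "{1, 4} \<union> B \<in> \<F> \<Longrightarrow> {1, 3} \<union> B \<in> \<F>"
    "{2, 3, 4} \<union> B \<in> \<F> \<Longrightarrow> {1, 3, 4} \<union> B \<in> \<F>" if "B \<subseteq> {5..n}" for B
    using shifted_pairs[OF sh that] by blast+
  have single: "{1} \<union> B \<in> \<F> \<Longrightarrow> {1, 3} \<union> B \<in> \<F>" if "B \<subseteq> {5..n}" for B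
    using up4[of "{1}" B "{1, 3}" B] that by auto
  have mono: "x {3, 4} \<le> x {2, 4}" "x {2, 4} \<le> x {2, 3}" "x {1, 4} \<le> x {1, 3}"
    "x {2, 3, 4} \<le> x {1, 3, 4}" "x {1} \<le> x {1, 3}"
    by (rule x_mono, rule pairs single; assumption)+
  have occ_up: "occurs I \<Longrightarrow> occurs J" if "I \<subseteq> J" "J \<subseteq> {1..4}" for I J
    using up4[of I "{5..n}" J "{5..n}"] that by auto
  have "x {1, 3, 4} + x {2, 3, 4} \<le> 1" by (rule cross[of _ _ "{1, 2}"]) (use occ12 in auto)
  with mono(4) have h: "x {1, 3, 4} + x {2, 3, 4} \<le> 1" "x {2, 3, 4} \<le> 1/2" by auto
  have \<rho>_mono: "\<rho> * y \<le> \<rho> * z" if "y \<le> z" for y z using that \<rho>_r(2) by (rule mult_left_mono)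
  have r_mono: "r * y \<le> r * z" if "y \<le> z" for y z using that r_bounds by (intro mult_left_mono) auto
  have \<rho>_self: "\<rho> * x {2} \<le> \<alpha> ^ 4 * t" "\<rho> * x {3} \<le> \<alpha> ^ 4 * t" "\<rho> * x {4} \<le> \<alpha> ^ 4 * t"
    "\<rho>\<^sup>2 * x {} \<le> \<alpha> ^ 5 * t\<^sup>2"
    using \<rho>_mono[OF x_self(4)] \<rho>_mono[OF x_self(5)] \<rho>_mono[OF x_self(6)]
      mult_left_mono[OF x_self(7), of "\<rho>\<^sup>2"] unfolding \<rho>_powers by simp_all
  have \<rho>_singles: "\<rho> * (x {1} + x {2} + x {3} + x {4})
      \<le> \<rho> * x {1, 3} + \<rho> * x {2} + \<rho> * x {3} + \<rho> * x {4}"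
    using \<rho>_mono[OF mono(5)] by (simp add: distrib_left)
  have numeric:
    "r * \<alpha>\<^sup>2 + 3 * \<alpha> ^ 5 + 3 * \<alpha> ^ 4 * t + \<alpha> ^ 5 * t\<^sup>2 + 1 < 2 * r"
    "3 * \<alpha> ^ 3 + \<alpha>\<^sup>2 + 2 * \<alpha> ^ 3 + \<alpha> * t + 3 * \<alpha> ^ 4 * t + \<alpha> ^ 5 * t\<^sup>2 < 2 * r"
    "3 * \<alpha> ^ 3 + 1/2 + 2 * \<alpha> ^ 4 + \<alpha>\<^sup>2 * t + 3 * \<alpha> ^ 4 * t + \<alpha> ^ 5 * t\<^sup>2 < 2 * r"
    "r / 2 + \<alpha> ^ 3 + \<alpha>\<^sup>2 + 2 * \<alpha> ^ 3 + \<alpha> * t < 2 * r"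
    "r / 2 + \<alpha> ^ 3 + \<alpha> + 2 * \<alpha> ^ 4 + \<alpha>\<^sup>2 * t < 2 * r"
    "1 + 2 * \<alpha> ^ 3 + \<alpha> ^ 4 * t + 2 * \<alpha> ^ 5 + \<alpha> ^ 3 * t < 2 * r"
    unfolding r_eq using levels_numeric[OF \<alpha>_bounds t_def] case34_high_numeric[OF \<alpha>_bounds t_def]
      case34_low_numeric[OF \<alpha>_bounds t_def] case23_high_numeric[OF \<alpha>_bounds t_def]
      case23_mid_numeric[OF \<alpha>_bounds t_def] case23_low_numeric[OF \<alpha>_bounds t_def] by blast+
  show ?thesis
  proof (cases "x {2, 3, 4} \<le> \<alpha>\<^sup>2 \<and> x {2, 3} \<le> \<alpha> ^ 5")
    case True
    have "\<rho> * (x {2} + x {3} + x {4}) \<le> 3 * \<alpha> ^ 4 * t" using \<rho>_self by (simp add: distrib_left)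
    moreover have "r * x {2, 3, 4} \<le> r * \<alpha>\<^sup>2" using True r_mono by blast
    ultimately show ?thesis
      using True mono(1,2) numeric(1) \<rho>_self(4) by (intro criterion_link) linarith
  next
    case False
    then consider (high) "x {1, 2} \<le> \<alpha>\<^sup>2" "x {1, 3} \<le> \<alpha> ^ 3" "\<rho> * x {1, 3} \<le> \<alpha> * t"
      | (mid) "x {1, 2} \<le> \<alpha>" "x {1, 3} \<le> \<alpha> ^ 4" "\<rho> * x {1, 3} \<le> \<alpha>\<^sup>2 * t"
      | (low) "x {1, 3} \<le> \<alpha> ^ 5" "\<rho> * x {1, 3} \<le> \<alpha> ^ 3 * t"
      using levels \<rho>_mono[of "x {1, 3}"] unfolding \<rho>_powers(1-3)[symmetric] by metis
    note split = this
    have \<alpha>54: "\<alpha> ^ 5 \<le> \<alpha> ^ 4" using \<alpha>_bounds by (intro power_decreasing) auto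
    show ?thesis
    proof (cases "occurs {3, 4}")
      case True
      \<comment> \<open>With {3, 4} and {1, 2} as third sets, the four triples form two
        cross-intersecting pairs, so \<open>?S \<le> 2\<close>. Since {3, 4} misses {1, 2}, also
        \<open>x {1, 2} \<le> 1/2\<close>.\<close>
      have "x {1, 2, 3} + x {1, 2, 4} \<le> 1" by (rule cross[of _ _ "{3, 4}"]) (use True in auto)
      then have "r * ?S \<le> r * 2" using h(1) by (intro r_mono) linarith
      moreover have "x {1, 2} + x {1, 2} \<le> 1" by (rule cross[of _ _ "{3, 4}"]) (use True in auto)
      moreover have "?K \<le> 3 * \<alpha> ^ 3" using x_self(1-3) by linarith
      moreover have "x {1, 2} + 2 * x {1, 3} + 3 * \<alpha> ^ 3 + \<rho> * x {1, 3} + 3 * \<alpha> ^ 4 * t + \<alpha> ^ 5 * t\<^sup>2 < 2 * r"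
        using split
      proof cases
        case high
        then show ?thesis using numeric(2) by linarith
      next
        case mid
        then show ?thesis using numeric(3) calculation(2) by linarith
      next
        case low
        have "\<rho> * x {1, 3} \<le> \<alpha>\<^sup>2 * t"
          using \<rho>_mono[of "x {1, 3}" "\<alpha> ^ 4"] low(1) \<alpha>54 unfolding \<rho>_powers by linarith
        then show ?thesis using low numeric(3) calculation(2) \<alpha>54 by linarith
      qed
      ultimately show ?thesis
        using mono(3) \<rho>_singles \<rho>_self by (intro criterion_total) linarith
    next
      case no34: False
      then have z34: "x {3, 4} = 0" "x {3} = 0" "x {4} = 0" "x {} = 0"
        using occ_up[of "{3}" "{3, 4}"] occ_up[of "{4}" "{3, 4}"] occ_up[of "{}" "{3, 4}"]
        by (auto intro!: x_eq_0)
      have half: "\<alpha> ^ 3 + \<alpha> ^ 4 * t \<le> r / 2"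
      proof -
        have "t \<le> 1" using \<alpha>(1) by (simp add: t_def)
        then have t4: "\<alpha> ^ 4 * t \<le> \<alpha> ^ 4 * 1" using \<alpha>(1) by (intro mult_left_mono) auto
        have sq: "\<alpha>\<^sup>2 \<le> 1/2"
        proof -
          have "\<alpha> * \<alpha> \<le> (6181/10000) * (6181/10000)" using \<alpha>_bounds by (intro mult_mono) auto
          then show ?thesis by (simp add: power2_eq_square)
        qed
        have "\<alpha>\<^sup>2 * \<alpha>\<^sup>2 \<le> \<alpha>\<^sup>2 * (1/2)" using sq by (intro mult_left_mono) auto
        then have p4: "\<alpha> ^ 4 \<le> \<alpha>\<^sup>2 / 2" by (simp flip: power_add)
        have "\<alpha> * \<alpha>\<^sup>2 \<le> \<alpha> * (1/2)" using sq \<alpha>(1) by (intro mult_left_mono) auto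
        then have p3: "\<alpha> ^ 3 \<le> \<alpha> / 2" by (simp add: power3_eq_cube power2_eq_square)
        show ?thesis unfolding r_eq using t4 p4 p3 by (simp add: add_divide_distrib)
      qed
      show ?thesis
      proof (cases "occurs {2, 4}")
        case True
        then have occ13: "occurs {1, 3}" using pairs(2,3)[of "{5..n}"] by blast
        \<comment> \<open>The triples are paired differently here, through {2, 4} and its shift {1,
          3}; again \<open>?S \<le> 2\<close>.\<close>
        have "x {1, 2, 3} + x {1, 3, 4} \<le> 1" by (rule cross[of _ _ "{2, 4}"]) (use True in auto)
        moreover have "x {1, 2, 4} + x {2, 3, 4} \<le> 1" by (rule cross[of _ _ "{1, 3}"]) (use occ13 in auto)
        ultimately have "r * ?S \<le> r * 2" by (intro r_mono) linarith
        moreover have "?K \<le> 2 * \<alpha> ^ 3" using x_self(1,2) z34 by linarith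
        moreover have "x {1, 2} + 2 * x {1, 3} + 2 * \<alpha> ^ 3 + \<rho> * x {1, 3} + \<alpha> ^ 4 * t < 2 * r"
          using split
        proof cases
          case high
          then show ?thesis using numeric(4) half by linarith
        next
          case mid
          then show ?thesis using numeric(5) half by linarith
        next
          case low
          then show ?thesis using numeric(6) x_le_1[of "{1, 2}"] by linarith
        qed
        ultimately show ?thesis
          using mono(3) \<rho>_singles \<rho>_self(1) z34 by (intro criterion_total) simp
      next
        case no24: False
        then have z24: "x {2, 4} = 0" "x {2} = 0"
          using occ_up[of "{2}" "{2, 4}"] by (auto intro!: x_eq_0)
        show ?thesis
        proof (cases "occurs {2, 3}")
          case True
          then have "occurs {1, 3}" using pairs(3)[of "{5..n}"] by blast
          then have occ134: "occurs {1, 3, 4}" using occ_up[of "{1, 3}" "{1, 3, 4}"] by simp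
          \<comment> \<open>Only one pair of triples is controlled by {2, 3}, so
            \<open>x {2, 3, 4}\<close> remains as an extra term.\<close>
          have "x {1, 2, 4} + x {1, 3, 4} \<le> 1" by (rule cross[of _ _ "{2, 3}"]) (use True in auto)
          then have "r * ?S \<le> r * (2 + x {2, 3, 4})"
            using x_le_1[of "{1, 2, 3}"] by (intro r_mono) linarith
          moreover have "r * (2 + x {2, 3, 4}) = 2 * r + r * x {2, 3, 4}" by (simp add: distrib_left)
          moreover have "r * x {2, 3, 4} \<le> r * (1/2)" using h(2) by (rule r_mono)
          moreover have "?K \<le> \<alpha> ^ 3" using x_self(1) z34 z24 by linarith
          moreover have "r * x {2, 3, 4} + x {1, 2} + 2 * x {1, 3} + \<alpha> ^ 3 + \<rho> * x {1, 3} < 2 * r"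
            using split
          proof cases
            case high
            then show ?thesis using numeric(4) calculation(3) by linarith
          next
            case mid
            then show ?thesis using numeric(5) calculation(3) by linarith
          next
            case low
            \<comment> \<open>Bounding both links separately would be too weak. Jointly they are at
              most 1, and r \<le> 1 lets this absorb \<open>r * x {2, 3, 4}\<close>.\<close>
            have "x {1, 2} + x {2, 3, 4} \<le> 1"
              by (rule cross[of _ _ "{1, 3, 4}"]) (use occ134 in auto)
            moreover have "r * x {2, 3, 4} \<le> 1 * x {2, 3, 4}"
              using r_bounds x_nonneg by (intro mult_right_mono) auto
            moreover have "0 \<le> \<alpha> ^ 3" "0 \<le> \<alpha> ^ 4 * t" using \<alpha>(1) t_nonneg by simp_all
            ultimately show ?thesis using low numeric(6) by linarith
          qed
          ultimately show ?thesis
            using mono(3) \<rho>_singles z34 z24 by (intro criterion_total) simp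
        next
          case no23: False
          then have z23: "x {2, 3} = 0" by (auto intro!: x_eq_0)
          show ?thesis
          proof (cases "r * x {2, 3, 4} < 2 * r - 1")
            case True
            then show ?thesis using z34 z24 z23 by (intro criterion_link) simp
          next
            case False
            \<comment> \<open>As \<open>x {2, 3, 4} \<le> 1/2\<close>, the link criterion can fail
              only if r / 2 \<ge> 2r - 1. This forces the endpoint r = 2/3, that is p = 2/5, and
              \<open>x {2, 3, 4} = 1/2\<close>. There \<alpha> is a fixed number just below
              458/1000, and the total criterion has room to spare.\<close>
            have "r * x {2, 3, 4} \<le> r * (1/2)" using h(2) by (rule r_mono)
            then have r23: "r = 2/3" using False r_bounds by linarith
            then have h2: "x {2, 3, 4} = 1/2" using False h(2) unfolding r23 by linarith
            then have "x {1, 3, 4} \<noteq> 0" using mono(4) by linarith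
            then have occ134: "occurs {1, 3, 4}" using x_eq_0[of "{1, 3, 4}"] by auto
            have "x {1, 2} + x {2, 3, 4} \<le> 1"
              by (rule cross[of _ _ "{1, 3, 4}"]) (use occ134 in auto)
            then have a: "x {1, 2} \<le> 1/2" using h2 by linarith
            have "?S \<le> 3" using h(1) x_le_1[of "{1, 2, 3}"] x_le_1[of "{1, 2, 4}"] by linarith
            then have "r * ?S \<le> r * 3" by (rule r_mono)
            moreover have \<rho>32: "\<rho> = 3/2" using \<rho>_r(1) r23 by simp
            have \<alpha>_le: "\<alpha> \<le> 458/1000"
            proof (rule ccontr)
              assume *: "\<not> ?thesis"
              then have "(458/1000) * (458/1000) \<le> \<alpha> * \<alpha>" by (intro mult_mono) auto
              then show False using * r23 unfolding r_eq power2_eq_square by simp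
            qed
            have pow: "\<alpha> ^ k \<le> (458/1000) ^ k" for k using \<alpha>_le \<alpha>(1) by (intro power_mono) auto
            have "x {1, 2} + 2 * x {1, 3} + 3/2 * x {1, 3} < 2/3"
              using split
            proof cases
              case high
              then show ?thesis using pow[of 2] pow[of 3] by (simp add: power_divide)
            next
              case mid
              then show ?thesis using \<alpha>_le pow[of 4] by (simp add: power_divide)
            next
              case low
              then show ?thesis using a pow[of 5] by (simp add: power_divide)
            qed
            then have "x {1, 2} + 2 * x {1, 3} + \<rho> * x {1, 3} < r" unfolding \<rho>32 r23 .
            ultimately show ?thesis
              using mono(3) \<rho>_singles z34 z24 z23 by (intro criterion_total) simp
          qed
        qed
      qed
    qed
  qed
qed

end

section \<open>All \<open>p\<close>\<close>

definition families :: "nat \<Rightarrow> real \<Rightarrow> nat set set set" where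
  "families n p =
     {\<F> \<in> t_families n 2. 2/5 \<le> p \<longrightarrow> three_wise_intersecting \<F>}"

lemma shift_class_families: "shift_class n (families n p)"
proof -
  have ins3: "three_wise_intersecting (insert B \<F>)"
    if "three_wise_intersecting \<F>" "A \<in> \<F>" "A \<subseteq> B" for A B \<F>
    unfolding three_wise_intersecting_def
  proof (intro ballI)
    fix G1 G2 G3 assume G: "G1 \<in> insert B \<F>" "G2 \<in> insert B \<F>" "G3 \<in> insert B \<F>"
    have "\<exists>H\<in>\<F>. H \<subseteq> G" if "G \<in> insert B \<F>" for G using that \<open>A \<in> \<F>\<close> \<open>A \<subseteq> B\<close> by auto
    then obtain H1 H2 H3 where "H1 \<in> \<F>" "H2 \<in> \<F>" "H3 \<in> \<F>" "H1 \<subseteq> G1" "H2 \<subseteq> G2" "H3 \<subseteq> G3"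
      using G by metis
    moreover from this have "H1 \<inter> H2 \<inter> H3 \<noteq> {}"
      using \<open>three_wise_intersecting \<F>\<close> by (auto simp: three_wise_intersecting_def)
    ultimately show "G1 \<inter> G2 \<inter> G3 \<noteq> {}" by blast
  qed
  have shift3: "three_wise_intersecting (shift i j \<F>)"
    if "three_wise_intersecting \<F>" "\<F> \<in> t_families n 2" "1 \<le> i \<and> i < j \<and> j \<le> n" for \<F> i j
    using that by (intro three_wise_intersecting_shift[of \<F> n]) (auto simp: t_families_def)
  have t: "\<F> \<subseteq> Pow {1..n}" "A \<in> \<F> \<Longrightarrow> A \<subseteq> B \<Longrightarrow> B \<subseteq> {1..n} \<Longrightarrow> insert B \<F> \<in> t_families n 2"
    "1 \<le> i \<Longrightarrow> i < j \<Longrightarrow> j \<le> n \<Longrightarrow> shift i j \<F> \<in> t_families n 2"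
    if "\<F> \<in> t_families n 2" for \<F> A B i j
    using shift_class_t_families[of n 2, unfolded shift_class_def, THEN conjunct2, rule_format] that
    by (auto simp: t_families_def)
  show ?thesis
    unfolding shift_class_def
  proof (intro conjI ballI allI impI)
    show "families n p \<subseteq> Pow (Pow {1..n})" using t(1) unfolding families_def by blast
  next
    fix \<F> A B assume "\<F> \<in> families n p" "A \<in> \<F>" "A \<subseteq> B \<and> B \<subseteq> {1..n}"
    then show "insert B \<F> \<in> families n p" using t(2)[of \<F> A B] ins3[of \<F> A B] by (simp add: families_def)
  next
    fix \<F> i j assume "\<F> \<in> families n p" "1 \<le> i \<and> i < j \<and> j \<le> n"
    then show "shift i j \<F> \<in> families n p" using t(3)[of \<F> i j] shift3[of \<F> i j] by (simp add: families_def)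
  qed
qed

lemma BD3_eq_threshold: "BD3 n = threshold n {1..4} 3"
  by (simp add: BD3_def threshold_def)

lemma BD3_in_families: "4 \<le> n \<Longrightarrow> BD3 n \<in> families n p"
  using BD3_in_nontrivial_families[of n] threshold_t_families[of "{1..4}" n 3]
  by (auto simp: families_def nontrivial_families_def BD3_eq_threshold)

lemma nontrivial_in_families:
  assumes "\<F> \<in> nontrivial_families n"
  shows "\<F> \<in> families n p"
proof -
  have F: "\<F> \<subseteq> Pow {1..n}" "three_wise_intersecting \<F>" "\<Inter>\<F> = {}"
    using assms by (auto simp: nontrivial_families_def non_trivial_def)
  have "2 \<le> card (A \<inter> B)" if "A \<in> \<F>" "B \<in> \<F>" for A B
  proof (rule ccontr)
    assume "\<not> 2 \<le> card (A \<inter> B)"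
    moreover have "finite (A \<inter> B)" using that F(1) finite_subset[of A "{1..n}"] by auto
    ultimately have "A \<inter> B \<subseteq> {z}" if "z \<in> A \<inter> B" for z
      using that card_le_Suc0_iff_eq[of "A \<inter> B"] by auto
    moreover have ABC: "A \<inter> B \<inter> C \<noteq> {}" if "C \<in> \<F>" for C
      using F(2) \<open>A \<in> \<F>\<close> \<open>B \<in> \<F>\<close> that by (auto simp: three_wise_intersecting_def)
    moreover obtain z where "z \<in> A \<inter> B" using ABC[OF \<open>A \<in> \<F>\<close>] by blast
    ultimately have "z \<in> C" if "C \<in> \<F>" for C using that by blast
    then show False using F(3) by blast
  qed
  then show ?thesis using F by (auto simp: families_def t_families_def t_intersecting_def)
qed

lemma p_measure_BD3:
  assumes "4 \<le> n"
  shows "p_measure n p (BD3 n) = 4 * p ^ 3 * (1 - p) + p ^ 4"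
proof -
  define lay where "lay k = {B. B \<subseteq> {1..4::nat} \<and> card B = k}" for k
  have card4: "card B \<le> 4" if "B \<subseteq> {1..4}" for B :: "nat set" using that card_mono[of "{1..4}" B] by simp
  have "3 \<le> card B \<longleftrightarrow> B \<in> lay 3 \<union> lay 4" if "B \<subseteq> {1..4}" for B
  proof -
    have "3 \<le> card B \<longleftrightarrow> card B = 3 \<or> card B = 4" using card4[OF that] by linarith
    then show ?thesis using that by (simp add: lay_def)
  qed
  then have "BD3 n = {A \<in> Pow {1..n}. A \<inter> {1..4} \<in> lay 3 \<union> lay 4}" by (simp add: BD3_def)
  also have "p_measure n p \<dots> = p_measure 4 p (lay 3 \<union> lay 4)"
    using assms by (intro p_measure_cylinder) (auto simp: lay_def)
  also have "\<dots> = (\<Sum>B\<in>lay 3. p ^ 3 * (1 - p)) + (\<Sum>B\<in>lay 4. p ^ 4)"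
    unfolding p_measure_def
    by (subst sum.union_disjoint) (auto simp: lay_def intro!: arg_cong2[where f = "(+)"] sum.cong)
  also have "\<dots> = 4 * p ^ 3 * (1 - p) + p ^ 4"
  proof -
    have "card (lay k) = 4 choose k" for k unfolding lay_def by (subst n_subsets) auto
    moreover have "4 choose 3 = (4::nat)" by (simp add: eval_nat_numeral)
    ultimately show ?thesis by simp
  qed
  finally show ?thesis .
qed

lemma p_measure_pair_threshold:
  assumes "2 \<le> n"
  shows "p_measure n p (threshold n {1..2} 2) = p\<^sup>2"
proof -
  have "2 \<le> card B \<longleftrightarrow> B \<in> {{1..2}}" if "B \<subseteq> {1..2}" for B :: "nat set"
    using that card_seteq[of "{1..2}" B] by auto
  then have "threshold n {1..2} 2 = {A \<in> Pow {1..n}. A \<inter> {1..2} \<in> {{1..2}}}"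
    by (simp add: threshold_def)
  also have "p_measure n p \<dots> = p_measure 2 p {{1..2}}" using assms by (intro p_measure_cylinder) auto
  finally show ?thesis by (simp add: p_measure_def)
qed

lemma optimal_shifted:
  assumes n: "4 \<le> n" and p: "1/3 \<le> p" "p \<le> 1/2"
    and opt: "optimal n p (families n p) \<F>" and up: "up_closed n \<F>" and sh: "shifted \<F>"
  shows "\<F> = threshold n {1..2} 2 \<or> \<F> = threshold n {1..4} 3"
proof (cases "p < 2/5")
  case True
  then have "families n p = t_families n 2" by (auto simp: families_def)
  then show ?thesis using optimal_shifted_small_p[of p n \<F>] n p opt sh True by simp
next
  case False
  have F: "\<F> \<subseteq> Pow {1..n}" "three_wise_intersecting \<F>" "t_intersecting 2 \<F>"
    using opt False by (auto simp: optimal_def families_def t_families_def)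
  have "\<F> \<subseteq> threshold n {1..4} 3"
  proof (rule ccontr)
    assume "\<not> ?thesis"
    then obtain A where A: "A \<in> \<F>" "\<not> 3 \<le> card (A \<inter> {1..4})" using F(1) by (auto simp: threshold_def)
    have "A \<subseteq> {1..n}" using A F(1) by blast
    moreover have "{1..n} = {1..4} \<union> {5..n}" using n by auto
    ultimately have "A \<subseteq> (A \<inter> {1..4}) \<union> {5..n}" "(A \<inter> {1..4}) \<union> {5..n} \<subseteq> {1..n}" by blast+
    then have "(A \<inter> {1..4}) \<union> {5..n} \<in> \<F>" using up A(1) by (auto simp: up_closed_def)
    then have occ: "{1, 2} \<union> {5..n} \<in> \<F>"
      using A(2) by (intro shifted_small_trace[OF up sh n, of _ "A \<inter> {1..4}"]) auto
    define d where "d = p / (1 - p)"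
    \<comment> \<open>The positive root of the quadratic required by the locale.\<close>
    define \<alpha> where "\<alpha> = (sqrt (1 + 4 * d) - 1) / 2"
    have d: "0 < d" using p by (simp add: d_def)
    have "(sqrt (1 + 4 * d))\<^sup>2 = 1 + 4 * d" using d by simp
    then have "\<alpha> + \<alpha>\<^sup>2 = d" by (simp add: \<alpha>_def power2_eq_square field_simps)
    moreover have "0 < \<alpha>" using d by (simp add: \<alpha>_def)
    ultimately interpret large_p n p \<alpha> \<F>
      using n p False F up sh by unfold_locales (auto simp: d_def)
    have "p_measure n p \<F> < p_measure n p (BD3 n)"
      using p_measure_less[OF occ] p_measure_BD3[OF n] by simp
    then show False using opt BD3_in_families[OF n] by (force simp: optimal_def)
  qed
  moreover have "threshold n {1..4} 3 \<in> families n p"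
    using BD3_in_families[OF n] by (simp add: BD3_eq_threshold)
  ultimately show ?thesis
    using optimal_eq_threshold[OF shift_class_families opt] p by auto
qed

text \<open>T is left arbitrary because undoing a shift may move it. The case k = 2 is not excluded
  here even for p > 1/3; the measure bound is carried along in the induction, so excluding it can
  wait for non-triviality.\<close>

lemma optimal_structure:
  assumes n: "4 \<le> n" and p: "1/3 \<le> p" "p \<le> 1/2" and opt: "optimal n p (families n p) \<F>"
  shows "p_measure n p \<F> \<le> p_measure n p (BD3 n) \<and>
    (\<exists>T\<subseteq>{1..n}. \<exists>k. (k = 2 \<or> k = 3) \<and> card T = 2 * k - 2 \<and> \<F> = threshold n T k)"
proof (rule optimal_shift_induct[OF shift_class_families _ _ opt])
  fix \<F> assume \<F>: "optimal n p (families n p) \<F>" "up_closed n \<F>" "shifted \<F>"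
  \<comment> \<open>This product is the measure of \<open>BD3\<close> minus p^2, which shows the
    role of 1/3.\<close>
  have "0 \<le> p\<^sup>2 * ((3 * p - 1) * (1 - p))" using p by (intro mult_nonneg_nonneg) auto
  then have "p\<^sup>2 \<le> 4 * p ^ 3 * (1 - p) + p ^ 4"
    by (simp add: algebra_simps eval_nat_numeral)
  then have le: "p_measure n p (threshold n {1..2} 2) \<le> p_measure n p (BD3 n)"
    using p_measure_pair_threshold[of n p] p_measure_BD3[OF n] n by simp
  have "\<F> = threshold n {1..2} 2 \<or> \<F> = threshold n {1..4} 3"
    using optimal_shifted[OF n p \<F>] .
  then show "p_measure n p \<F> \<le> p_measure n p (BD3 n) \<and>
    (\<exists>T\<subseteq>{1..n}. \<exists>k. (k = 2 \<or> k = 3) \<and> card T = 2 * k - 2 \<and> \<F> = threshold n T k)"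
  proof
    assume "\<F> = threshold n {1..2} 2"
    then show ?thesis using le n by (intro conjI exI[of _ "{1..2}"] exI[of _ 2]) auto
  next
    assume "\<F> = threshold n {1..4} 3"
    then show ?thesis using n by (intro conjI exI[of _ "{1..4}"] exI[of _ 3]) (auto simp: BD3_eq_threshold)
  qed
next
  fix \<F> i j assume \<F>: "optimal n p (families n p) \<F>" and ij: "1 \<le> i" "i < j" "j \<le> n"
    and IH: "p_measure n p (shift i j \<F>) \<le> p_measure n p (BD3 n) \<and>
      (\<exists>T\<subseteq>{1..n}. \<exists>k. (k = 2 \<or> k = 3) \<and> card T = 2 * k - 2 \<and> shift i j \<F> = threshold n T k)"
  have F: "\<F> \<in> t_families n 2" "\<F> \<subseteq> Pow {1..n}"
    using \<F> by (auto simp: optimal_def families_def t_families_def)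
  obtain T k where "k = 2 \<or> k = 3" "T \<subseteq> {1..n}" "card T = 2 * k - 2" "shift i j \<F> = threshold n T k"
    using IH by blast
  then have "\<exists>T'\<subseteq>{1..n}. card T' = 2 * k - 2 \<and> \<F> = threshold n T' k"
    using shift_eq_threshold[OF F(1) ij] by blast
  moreover have "p_measure n p (shift i j \<F>) = p_measure n p \<F>"
    using F(2) ij by (intro p_measure_shift) auto
  ultimately show "p_measure n p \<F> \<le> p_measure n p (BD3 n) \<and>
    (\<exists>T\<subseteq>{1..n}. \<exists>k. (k = 2 \<or> k = 3) \<and> card T = 2 * k - 2 \<and> \<F> = threshold n T k)"
    using IH \<open>k = 2 \<or> k = 3\<close> by metis
qed (use p in auto)

lemma threshold_isomorphic_BD3:
  assumes n: "4 \<le> n" and T: "T \<subseteq> {1..n}" "card T = 4"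
  shows "isomorphic_families n (threshold n T 3) (BD3 n)"
proof -
  have finT: "finite T" using T(1) finite_subset by auto
  obtain f where f: "bij_betw f {1..4::nat} T" using finite_same_card_bij[of "{1..4::nat}" T] finT T(2) by auto
  have "card ({1..n} - {1..4}) = card ({1..n} - T)"
    using n T finT by (simp add: card_Diff_subset)
  then obtain g where g: "bij_betw g ({1..n} - {1..4}) ({1..n} - T)"
    using finite_same_card_bij[of "{1..n} - {1..4}" "{1..n} - T"] by auto
  define \<tau> where "\<tau> x = (if x \<in> {1..4} then f x else if x \<in> {1..n} then g x else x)" for x
  have bT: "bij_betw \<tau> {1..4} T" using f by (subst bij_betw_cong[of _ _ f]) (auto simp: \<tau>_def)
  have "bij_betw \<tau> ({1..n} - {1..4}) ({1..n} - T)"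
    using g by (subst bij_betw_cong[of _ _ g]) (auto simp: \<tau>_def)
  with bT have "bij_betw \<tau> ({1..4} \<union> ({1..n} - {1..4})) (T \<union> ({1..n} - T))"
    by (rule bij_betw_combine) auto
  moreover have "{1..4} \<union> ({1..n} - {1..4}) = {1..n}" "T \<union> ({1..n} - T) = {1..n}" using n T by auto
  ultimately have perm: "\<tau> permutes {1..n}" using n by (intro bij_imp_permutes) (auto simp: \<tau>_def)
  have inj: "inj \<tau>" by (rule permutes_inj[OF perm])
  have img: "\<tau> ` {1..4} = T" using bT by (simp add: bij_betw_def)
  have key: "\<tau> ` G \<in> threshold n T 3 \<longleftrightarrow> G \<in> BD3 n" for G
  proof -
    have "\<tau> ` G \<subseteq> {1..n} \<longleftrightarrow> G \<subseteq> {1..n}"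
      using inj_image_subset_iff[OF inj, of G "{1..n}"] permutes_image[OF perm] by simp
    moreover have "\<tau> ` G \<inter> T = \<tau> ` (G \<inter> {1..4})" unfolding img[symmetric] by (simp add: image_Int[OF inj])
    moreover have "card (\<tau> ` (G \<inter> {1..4})) = card (G \<inter> {1..4})"
      using inj by (intro card_image) (auto intro: inj_on_subset)
    ultimately show ?thesis by (simp add: threshold_def BD3_def)
  qed
  have "threshold n T 3 = {\<tau> ` G | G. G \<in> BD3 n}"
  proof (intro equalityI subsetI)
    fix A assume A: "A \<in> threshold n T 3"
    have "\<tau> ` (inv \<tau> ` A) = A" by (rule image_f_inv_f[OF permutes_surj[OF perm]])
    then have "inv \<tau> ` A \<in> BD3 n" using A key[of "inv \<tau> ` A"] by simp
    then show "A \<in> {\<tau> ` G | G. G \<in> BD3 n}" using \<open>\<tau> ` (inv \<tau> ` A) = A\<close> by blast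
  next
    fix A assume "A \<in> {\<tau> ` G | G. G \<in> BD3 n}"
    then show "A \<in> threshold n T 3" using key by auto
  qed
  then show ?thesis using perm unfolding isomorphic_families_def by blast
qed

theorem theorem4:
  fixes n :: nat and p :: real
  assumes "n \<ge> 4" and "1/3 \<le> p" and "p \<le> 1/2"
  shows "M3 n p = p_measure n p (BD3 n) \<and>
    (\<forall>\<F>. \<F> \<subseteq> Pow {1..n} \<and> three_wise_intersecting \<F> \<and> non_trivial \<F> \<and>
       p_measure n p \<F> = M3 n p \<longrightarrow> isomorphic_families n \<F> (BD3 n))"
proof -
  obtain \<F>0 where "optimal n p (families n p) \<F>0"
    using optimal_exists[OF shift_class_families] BD3_in_families[OF assms(1)] by blast
  then have le: "p_measure n p \<G> \<le> p_measure n p (BD3 n)" if "\<G> \<in> families n p" for \<G>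
    using optimal_structure[OF assms, of \<F>0] that by (force simp: optimal_def)
  have M: "M3 n p = p_measure n p (BD3 n)"
    unfolding M3_def
  proof (rule Max_eqI)
    fix y assume "y \<in> p_measure n p ` nontrivial_families n"
    then show "y \<le> p_measure n p (BD3 n)" using le nontrivial_in_families by auto
  qed (use finite_nontrivial_families BD3_in_nontrivial_families[OF assms(1)] in auto)
  have "isomorphic_families n \<F> (BD3 n)"
    if F: "\<F> \<subseteq> Pow {1..n}" "three_wise_intersecting \<F>" "non_trivial \<F>" "p_measure n p \<F> = M3 n p"
    for \<F>
  proof -
    have "\<F> \<in> families n p"
      using F by (intro nontrivial_in_families) (simp add: nontrivial_families_def)
    \<comment> \<open>\<open>BD3\<close> attains the maximum of the larger class as well, so a
      maximal non-trivial family is optimal there too.\<close>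
    then have "optimal n p (families n p) \<F>" using le F(4) M by (simp add: optimal_def)
    then obtain T k where T: "T \<subseteq> {1..n}" "k = 2 \<or> k = 3" "card T = 2 * k - 2" "\<F> = threshold n T k"
      using optimal_structure[OF assms] by blast
    have "k \<noteq> 2"
    proof
      assume "k = 2"
      then have T2: "card T = 2" "finite T" using T(3) by (auto intro: card_ge_0_finite)
      have "T \<subseteq> A" if "A \<in> \<F>" for A
      proof -
        have "2 \<le> card (A \<inter> T)" using that T(4) \<open>k = 2\<close> by (simp add: threshold_def)
        then have "A \<inter> T = T" using T2 by (intro card_seteq) auto
        then show ?thesis by blast
      qed
      then have "T \<subseteq> \<Inter>\<F>" by blast
      then show False using F(3) T2 by (auto simp: non_trivial_def)
    qed
    then show ?thesis using threshold_isomorphic_BD3[OF assms(1) T(1)] T by simp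
  qed
  then show ?thesis using M by blast
qed

end
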